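(* Let $\mu\in M_+(\mathbb D^-)$, let $b\in H^\infty_1$ be $\mu$-admissible and not inner, let $h=d(\mu|\mathbb T)/dm$, and let $Z_b:=\{\zeta\in\mathbb T:|b(\zeta)|<1\}$. If $\mu$ is a reverse Carleson measure for $\mathscr H(b)$, then $h\not\equiv0$ (that is, $h$ is not $m$-a.e. zero) and $$\int_{Z_b}\frac1{1-|b|}\,dm<\infty.$$
   Context: $\mathbb D$ is the open unit disk, $\mathbb D^-$ its closure, $\mathbb T=\partial\mathbb D$, $m$ normalized Lebesgue measure on $\mathbb T$. $H^\infty_1$ is the closed unit ball of $H^\infty$ (bounded analytic functions on $\mathbb D$ with sup norm). $b$ is inner if $|b|=1$ $m$-a.e. on $\mathbb T$. For $b\in H^\infty_1$, the de Branges–Rovnyak space $\mathscr H(b)$ is the reproducing kernel Hilbert space of analytic functions on $\mathbb D$ with reproducing kernel $k^b_\lambda(z)=\frac{1-\overline{b(\lambda)}b(z)}{1-\overline\lambda z}$ ($\lambda,z\in\mathbb D$); its norm is denoted $\|\cdot\|_b$. It is contractively contained in $H^2$. $M_+(\mathbb D^-)$ is the set of positive finite Borel measures on $\mathbb D^-$. For $\mu\in M_+(\mathbb D^-)$, an analytic function $f$ on $\mathbb D$ is $\mu$-admissible if its non-tangential limits exist $\mu$-almost everywhere on $\mathbb T$; such an $f$ is extended $\mu$-a.e. to $\mathbb T$ by its non-tangential limits, and $\|f\|_\mu\in[0,+\infty]$ denotes its $L^2(\mu)$ norm. $\mathscr H(b)_\mu$ is the set of $\mu$-admissible functions in $\mathscr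 H(b)$. The measure $\mu$ is a reverse Carleson measure for $\mathscr H(b)$ if $\mathscr H(b)_\mu$ is dense in $\mathscr H(b)$ and there is a constant $C>0$ with $\|f\|_b\le C\|f\|_\mu$ for all $f\in\mathscr H(b)_\mu$. $d(\mu|\mathbb T)/dm$ is the Radon–Nikodym derivative of the absolutely continuous part (with respect to $m$) of the restriction of $\mu$ to $\mathbb T$. *)

theory Defs
  imports "HOL-Analysis.Analysis"
begin

abbreviation unit_disc :: "complex set" where
  "unit_disc \<equiv> ball 0 1"

abbreviation unit_circle :: "complex set" where
  "unit_circle \<equiv> sphere 0 1"

definition circle_measure :: "complex measure" where
  "circle_measure =
     distr (uniform_measure lborel {0..2 * pi}) (restrict_space borel unit_circle) cis"

definition Hinf_unit_ball :: "(complex \<Rightarrow> complex) set" where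
  "Hinf_unit_ball = {f. f holomorphic_on unit_disc \<and> (\<forall>z\<in>unit_disc. cmod (f z) \<le> 1)}"

definition stolz_region :: "complex \<Rightarrow> real \<Rightarrow> complex set" where
  "stolz_region \<zeta> \<alpha> = {z \<in> unit_disc. cmod (z - \<zeta>) < \<alpha> * (1 - cmod z)}"

definition has_nt_limit :: "(complex \<Rightarrow> complex) \<Rightarrow> complex \<Rightarrow> complex \<Rightarrow> bool" where
  "has_nt_limit f \<zeta> L \<longleftrightarrow> (\<forall>\<alpha>>1. (f \<longlongrightarrow> L) (at \<zeta> within stolz_region \<zeta> \<alpha>))"

definition nt_convergent :: "(complex \<Rightarrow> complex) \<Rightarrow> complex \<Rightarrow> bool" where
  "nt_convergent f \<zeta> \<longleftrightarrow> (\<exists>L. has_nt_limit f \<zeta> L)"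

text \<open>The extension of a function on the disc by its non-tangential limits. The value is set
  to 0 at the points of the circle where the limit does not exist; below this only happens on
  null sets of the measure in question.\<close>

definition nt_ext :: "(complex \<Rightarrow> complex) \<Rightarrow> complex \<Rightarrow> complex" where
  "nt_ext f z =
     (if z \<in> unit_disc then f z
      else if z \<in> unit_circle \<and> nt_convergent f z then (THE L. has_nt_limit f z L)
      else 0)"

definition inner_function :: "(complex \<Rightarrow> complex) \<Rightarrow> bool" where
  "inner_function b \<longleftrightarrow>
     b \<in> Hinf_unit_ball \<and>
     (AE \<zeta> in circle_measure. nt_convergent b \<zeta> \<and> cmod (nt_ext b \<zeta>) = 1)"

text \<open>The pair of \<open>H\<close> and \<open>ip\<close> is the Hilbert space of functions on \<open>X\<close> with reproducing
  kernel \<open>K\<close>, where \<open>K y\<close> is the kernel function at the point \<open>y\<close>. It is determined by \<open>X\<close>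
  and \<open>K\<close>, up to the values of \<open>ip\<close> outside \<open>H\<close>. Functions on \<open>X\<close> are represented as total
  functions that vanish outside \<open>X\<close>. The inner product is linear in its first argument.\<close>

locale reproducing_kernel_hilbert_space =
  fixes X :: "'a set"
    and K :: "'a \<Rightarrow> 'a \<Rightarrow> complex"
    and H :: "('a \<Rightarrow> complex) set"
    and ip :: "('a \<Rightarrow> complex) \<Rightarrow> ('a \<Rightarrow> complex) \<Rightarrow> complex"
  assumes outside: "f \<in> H \<Longrightarrow> x \<notin> X \<Longrightarrow> f x = 0"
    and zero_mem: "(\<lambda>_. 0) \<in> H"
    and add_mem: "f \<in> H \<Longrightarrow> g \<in> H \<Longrightarrow> (\<lambda>x. f x + g x) \<in> H"
    and scale_mem: "f \<in> H \<Longrightarrow> (\<lambda>x. c * f x) \<in> H"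
    and ip_add: "f \<in> H \<Longrightarrow> g \<in> H \<Longrightarrow> u \<in> H \<Longrightarrow> ip (\<lambda>x. f x + g x) u = ip f u + ip g u"
    and ip_scale: "f \<in> H \<Longrightarrow> u \<in> H \<Longrightarrow> ip (\<lambda>x. c * f x) u = c * ip f u"
    and ip_commute: "f \<in> H \<Longrightarrow> g \<in> H \<Longrightarrow> ip g f = cnj (ip f g)"
    and ip_pos: "f \<in> H \<Longrightarrow> f \<noteq> (\<lambda>_. 0) \<Longrightarrow> 0 < Re (ip f f)"
    and complete:
      "\<lbrakk>\<And>n. s n \<in> H;
        \<forall>e>0. \<exists>N. \<forall>m\<ge>N. \<forall>n\<ge>N.
          sqrt (Re (ip (\<lambda>x. s m x - s n x) (\<lambda>x. s m x - s n x))) < e\<rbrakk>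
       \<Longrightarrow> \<exists>f\<in>H. (\<lambda>n. sqrt (Re (ip (\<lambda>x. s n x - f x) (\<lambda>x. s n x - f x)))) \<longlonglongrightarrow> 0"
    and kernel_mem: "y \<in> X \<Longrightarrow> K y \<in> H"
    and reproducing: "f \<in> H \<Longrightarrow> y \<in> X \<Longrightarrow> ip f (K y) = f y"

definition ip_norm ::
    "((complex \<Rightarrow> complex) \<Rightarrow> (complex \<Rightarrow> complex) \<Rightarrow> complex) \<Rightarrow> (complex \<Rightarrow> complex) \<Rightarrow> real" where
  "ip_norm ip f = sqrt (Re (ip f f))"

definition dBR_kernel :: "(complex \<Rightarrow> complex) \<Rightarrow> complex \<Rightarrow> complex \<Rightarrow> complex" where
  "dBR_kernel b w z =
     (if z \<in> unit_disc then (1 - cnj (b w) * b z) / (1 - cnj w * z) else 0)"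

definition de_Branges_Rovnyak ::
    "(complex \<Rightarrow> complex) \<Rightarrow> (complex \<Rightarrow> complex) set
       \<Rightarrow> ((complex \<Rightarrow> complex) \<Rightarrow> (complex \<Rightarrow> complex) \<Rightarrow> complex) \<Rightarrow> bool" where
  "de_Branges_Rovnyak b H ip \<longleftrightarrow>
     reproducing_kernel_hilbert_space unit_disc (dBR_kernel b) H ip \<and>
     (\<forall>f\<in>H. f holomorphic_on unit_disc)"

definition disc_measures :: "complex measure set" where
  "disc_measures =
     {\<mu>. finite_measure \<mu> \<and> sets \<mu> = sets (restrict_space borel (cball 0 1))}"

definition admissible :: "complex measure \<Rightarrow> (complex \<Rightarrow> complex) \<Rightarrow> bool" where
  "admissible \<mu> f \<longleftrightarrow>
     f holomorphic_on unit_disc \<and> (AE \<zeta> in \<mu>. \<zeta> \<in> unit_circle \<longrightarrow> nt_convergent f \<zeta>)"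

definition L2_norm :: "complex measure \<Rightarrow> (complex \<Rightarrow> complex) \<Rightarrow> ennreal" where
  "L2_norm \<mu> f =
     (let I = (\<integral>\<^sup>+ z. ennreal ((cmod (nt_ext f z))\<^sup>2) \<partial>\<mu>)
      in if I = \<infinity> then \<infinity> else ennreal (sqrt (enn2real I)))"

definition reverse_Carleson ::
    "complex measure \<Rightarrow> (complex \<Rightarrow> complex) set
       \<Rightarrow> ((complex \<Rightarrow> complex) \<Rightarrow> (complex \<Rightarrow> complex) \<Rightarrow> complex) \<Rightarrow> bool" where
  "reverse_Carleson \<mu> H ip \<longleftrightarrow>
     (\<forall>f\<in>H. \<forall>e>0. \<exists>g\<in>H. admissible \<mu> g \<and> ip_norm ip (\<lambda>z. f z - g z) < e) \<and>
     (\<exists>C::real. C > 0 \<and>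
        (\<forall>f\<in>H. admissible \<mu> f \<longrightarrow> ennreal (ip_norm ip f) \<le> ennreal C * L2_norm \<mu> f))"

definition lebesgue_decomposition ::
    "'a measure \<Rightarrow> 'a measure \<Rightarrow> 'a measure \<Rightarrow> 'a measure \<Rightarrow> bool" where
  "lebesgue_decomposition M N Na Ns \<longleftrightarrow>
     sets Na = sets M \<and> sets Ns = sets M \<and>
     absolutely_continuous M Na \<and>
     (\<exists>S\<in>null_sets M. emeasure Ns (space M - S) = 0) \<and>
     (\<forall>A\<in>sets M. emeasure N A = emeasure Na A + emeasure Ns A)"

text \<open>The decomposition, and hence the description below, is unique when \<open>N\<close> is finite.\<close>

definition ac_part :: "'a measure \<Rightarrow> 'a measure \<Rightarrow> 'a measure" where
  "ac_part M N = (THE Na. \<exists>Ns. lebesgue_decomposition M N Na Ns)"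

definition circle_density :: "complex measure \<Rightarrow> complex \<Rightarrow> ennreal" where
  "circle_density \<mu> =
     RN_deriv circle_measure (ac_part circle_measure (restrict_space \<mu> unit_circle))"

end

theory Submission
  imports Defs "HOL-Complex_Analysis.Complex_Analysis"
begin

text \<open>Test the reverse Carleson inequality on the kernel functions $k_{r\zeta}$. After
  multiplication by $1 - r^2$ it bounds $1 - |b(r\zeta)|^2$ by the Poisson-type integral of
  $|1 - \overline{b(r\zeta)} b|^2$ against $\mu$. Integrating over $\zeta$ in a compact set $K$ on
  which $b(r\zeta)$ stays within $(1 - |a|)/4$ of a constant $a$ and letting $r \to 1$ kills the
  part of $\mu$ off $K$, which leaves $(1 - |a|)\, m(K) \le C' (1 - |a|)^2 \mu(K)$. Countably many
  such level sets cover $Z_b$, so summing gives the integral bound, without any differentiation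
  of measures. If $h = 0$, then $\mu$ restricted to the circle lives on an $m$-null set, so the
  level sets and hence $Z_b$ are null; as nontangential limits of $b$ exist almost everywhere by
  Fatou's theorem, $b$ would be inner.

  Fatou's theorem is derived from the primitive $F$ of $b$: it is Lipschitz up to the
  boundary, so it is differentiable along the circle almost everywhere, and at such points
  $F' = b$ has a nontangential limit.\<close>

section \<open>Lebesgue measure on the circle and the Poisson kernel\<close>

text \<open>The gain that drives the estimate is quadratic. For \<open>\<zeta>\<close> and
  \<open>z\<close> in one level set, both \<open>b (r * \<zeta>)\<close> and \<open>b z\<close> lie
  close to the same constant \<open>a\<close> relative to \<open>1 - |a|\<close>, so
  \<open>|1 - cnj (b (r * \<zeta>)) * b z|^2\<close> is of order \<open>(1 - |a|)^2\<close>, whereas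
  \<open>1 - |b (r * \<zeta>)|^2\<close> on the left is only of order \<open>1 - |a|\<close>.
  Dividing by \<open>(1 - |a|)^2\<close> leaves \<open>m(K) / (1 - |a|)\<close> bounded by a
  multiple of \<open>\<mu>(K)\<close>. On the level set \<open>1 / (1 - |b|)\<close> is at most a
  multiple of \<open>1 / (1 - |a|)\<close>, and the total over disjoint pieces is controlled by the
  finite mass of \<open>\<mu>\<close>.

  The level sets are cut out by the values of \<open>b\<close> on radii, from a common radius on:
  the boundary value alone would not control \<open>b (r * \<zeta>)\<close> for all
  \<open>\<zeta>\<close> in \<open>K\<close> at the same \<open>r\<close>. Compactness of
  \<open>K\<close> keeps the Poisson kernel away from every point outside \<open>K\<close>, on the
  circle as well as inside the disc. At points of \<open>K\<close> the potential is only bounded by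
  1, and there \<open>\<mu>\<close> may have any singular part.\<close>

lemma poisson_kernel_has_integral:
  assumes z: "cmod z < 1"
  shows "((\<lambda>t. (1 - (cmod z)\<^sup>2) / (cmod (cis t - z))\<^sup>2) has_integral 2 * pi) {0..2 * pi}"
proof -
  define c where "c = 1 - (cmod z)\<^sup>2"
  have c: "c > 0" using z by (simp add: c_def power_less_one_iff)
  have cc: "of_real c = 1 - cnj z * z"
    by (simp add: c_def complex_norm_square[symmetric] mult.commute)
  \<comment> \<open>On the circle \<open>1 - cnj z * u = u * cnj (u - z)\<close>, so
    \<open>g u * u / (u - z)\<close> equals \<open>1 / |u - z|^2\<close>, while
    \<open>g z = 1 / (1 - |z|^2)\<close>. Cauchy's formula for \<open>g\<close> is therefore the
    Poisson integral up to constants.\<close>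
  define g where "g u = 1 / (1 - cnj z * u)" for u
  have nz: "1 - cnj z * u \<noteq> 0" if "cmod u \<le> 1" for u
  proof
    assume "1 - cnj z * u = 0"
    then have "1 = cmod z * cmod u" by (metis complex_mod_cnj eq_iff_diff_eq_0 norm_mult norm_one)
    also have "\<dots> \<le> cmod z" using that by (simp add: mult_left_le)
    finally show False using z by simp
  qed
  have "((\<lambda>u. g u / (u - z)) has_contour_integral (2 * of_real pi * \<i> * g z)) (circlepath 0 1)"
  proof (rule Cauchy_integral_circlepath)
    show "continuous_on (cball 0 1) g" unfolding g_def
      by (intro continuous_intros) (use nz in auto)
    show "g holomorphic_on ball 0 1" unfolding g_def
      by (intro holomorphic_intros) (use nz in auto)
  qed (use z in auto)
  moreover have "g z = 1 / of_real c" by (simp add: g_def cc)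
  ultimately have "((\<lambda>t. g (cis t) / (cis t - z) * \<i> * cis t) has_integral (2 * of_real pi * \<i> / of_real c)) {0..2 * pi}"
    by (simp add: circlepath_def has_contour_integral_part_circlepath_iff)
  then have "((\<lambda>t. - \<i> * of_real c * (g (cis t) / (cis t - z) * \<i> * cis t)) has_integral
      (- \<i> * of_real c * (2 * of_real pi * \<i> / of_real c))) {0..2 * pi}"
    by (rule has_integral_mult_right)
  also have "(- \<i> * of_real c * (2 * of_real pi * \<i> / of_real c)) = of_real (2 * pi)"
    using c by (simp add: field_simps)
  also have "(\<lambda>t. - \<i> * of_real c * (g (cis t) / (cis t - z) * \<i> * cis t)) = (\<lambda>t. of_real (c / (cmod (cis t - z))\<^sup>2))"
  proof
    fix t
    have 1: "1 - cnj z * cis t = cis t * cnj (cis t - z)"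
      by (simp add: algebra_simps cis_cnj cis_mult)
    have 2: "of_real ((cmod (cis t - z))\<^sup>2) = (cis t - z) * cnj (cis t - z)"
      by (rule complex_norm_square)
    have 3: "\<i> * of_real c * \<i> = - of_real c" by (simp add: complex_eq_iff)
    show "- \<i> * of_real c * (g (cis t) / (cis t - z) * \<i> * cis t) = of_real (c / (cmod (cis t - z))\<^sup>2)"
      unfolding g_def of_real_divide 1 2 using 3 by (simp add: mult.commute[of "cnj _"] del: complex_cnj_diff)
  qed
  finally have "((Re \<circ> (\<lambda>t. complex_of_real (c / (cmod (cis t - z))\<^sup>2))) has_integral Re (of_real (2 * pi))) {0..2 * pi}"
    by (rule has_integral_linear[OF _ bounded_linear_Re])
  then show ?thesis unfolding c_def o_def Re_complex_of_real .
qed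

section \<open>Normalized Lebesgue measure on the circle in the angle variable\<close>

lemma cis_measurable [measurable]: "cis \<in> borel \<rightarrow>\<^sub>M restrict_space borel unit_circle"
  by (rule measurable_restrict_space2) (auto intro!: borel_measurable_continuous_onI continuous_intros)

lemma space_circle_measure [simp]: "space circle_measure = unit_circle"
  and sets_circle_measure [simp, measurable_cong]: "sets circle_measure = sets (restrict_space borel unit_circle)"
  by (simp_all add: circle_measure_def space_restrict_space)

lemma nn_integral_circle_measure:
  assumes [measurable]: "f \<in> borel_measurable (restrict_space borel unit_circle)"
  shows "(\<integral>\<^sup>+\<zeta>. f \<zeta> \<partial>circle_measure) = (\<integral>\<^sup>+t\<in>{0..2 * pi}. f (cis t) \<partial>lborel) / ennreal (2 * pi)"
proof -
  have *: "cis \<in> uniform_measure lborel {0..2 * pi} \<rightarrow>\<^sub>M restrict_space borel unit_circle"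
    using cis_measurable by (simp cong: measurable_cong_sets)
  show ?thesis
    unfolding circle_measure_def
    by (subst nn_integral_distr[OF *]) (simp_all add: nn_integral_uniform_measure)
qed

lemma emeasure_circle_measure_space: "emeasure circle_measure unit_circle = 1"
  using nn_integral_circle_measure[of "\<lambda>_. 1"]
  by (simp add: one_ennreal_def[symmetric])

interpretation circle_measure: finite_measure circle_measure
  by standard (simp add: emeasure_circle_measure_space)

text \<open>A negligible set of angles need not be Borel, and a pushforward measure controls
  preimages rather than images. So \<open>N\<close> is enlarged to a Borel null set, which is then
  pulled back along a Borel inverse of \<open>cis\<close>.\<close>

lemma AE_circle_measure_cis:
  assumes "negligible N"
  shows "AE \<zeta> in circle_measure. \<exists>t. t \<notin> N \<and> \<zeta> = cis t"
proof -
  \<comment> \<open>The angle 0 joins the null set because the branch used below gives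
    \<open>a (cis 0) = 2 * pi\<close>.\<close>
  have "negligible (insert 0 N)" using assms by simp
  then obtain N' where N': "N' \<in> null_sets lborel" "insert 0 N \<subseteq> N'"
    unfolding negligible_iff_null_sets null_sets_completion_iff2 by blast
  have [measurable]: "N' \<in> sets borel" using N' by auto
  \<comment> \<open>A Borel inverse of \<open>cis\<close> on the half-open interval from \<open>0\<close> (excluded) to \<open>2 pi\<close>.\<close>
  define a where "a w = Im (Ln (- w)) + pi" for w
  have "a \<in> borel_measurable borel" unfolding a_def by measurable
  then have [measurable]: "a \<in> borel_measurable (restrict_space borel unit_circle)"
    by (rule measurable_restrict_space1)
  have "AE t in lborel. t \<notin> N'" using N'(1) by (rule AE_not_in)
  then have "AE t in lborel. t \<in> {0..2 * pi} \<longrightarrow> a (cis t) \<notin> N'"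
  proof eventually_elim
    case (elim t)
    show ?case
    proof
      assume t: "t \<in> {0..2 * pi}"
      have "t \<noteq> 0" using elim N' by auto
      have "- cis t = exp (\<i> * of_real (t - pi))"
        unfolding cis_conv_exp[symmetric] by (simp flip: cis_divide)
      moreover have "Ln (exp (\<i> * of_real (t - pi))) = \<i> * of_real (t - pi)"
        by (rule Ln_exp) (use t \<open>t \<noteq> 0\<close> in auto)
      ultimately have "a (cis t) = t" by (simp add: a_def)
      then show "a (cis t) \<notin> N'" using elim by simp
    qed
  qed
  then have "AE t in uniform_measure lborel {0..2 * pi}. a (cis t) \<notin> N'"
    by (intro AE_uniform_measureI) auto
  then have "AE \<zeta> in circle_measure. a \<zeta> \<notin> N'"
    unfolding circle_measure_def
  proof (subst AE_distr_iff)
    show "cis \<in> uniform_measure lborel {0..2 * pi} \<rightarrow>\<^sub>M restrict_space borel unit_circle"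
      using cis_measurable by (simp cong: measurable_cong_sets)
  qed measurable
  then show ?thesis
  proof (rule AE_mp, intro AE_I2 impI)
    fix \<zeta> assume \<zeta>: "\<zeta> \<in> space circle_measure" "a \<zeta> \<notin> N'"
    have "\<zeta> \<noteq> 0" using \<zeta> by auto
    then have "Ln (- \<zeta>) = \<i> * of_real (Im (Ln (- \<zeta>)))"
      using \<zeta> by (simp add: complex_eq_iff)
    then have "- \<zeta> = cis (Im (Ln (- \<zeta>)))"
      by (metis \<open>\<zeta> \<noteq> 0\<close> cis_conv_exp exp_Ln neg_equal_0_iff_equal)
    then have "\<zeta> = cis (a \<zeta>)" by (simp add: a_def cis_mult[symmetric] minus_equation_iff)
    then show "\<exists>t. t \<notin> N \<and> \<zeta> = cis t" using \<zeta> N' by auto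
  qed
qed

lemma poisson_kernel_circle_measure:
  assumes z: "cmod z < 1"
  shows "(\<integral>\<^sup>+\<zeta>. ennreal ((1 - (cmod z)\<^sup>2) / (cmod (\<zeta> - z))\<^sup>2) \<partial>circle_measure) = 1"
proof -
  have z2: "0 \<le> 1 - (cmod z)\<^sup>2" using z by (simp add: power_le_one)
  have "(\<integral>\<^sup>+t\<in>{0..2 * pi}. ennreal ((1 - (cmod z)\<^sup>2) / (cmod (cis t - z))\<^sup>2) \<partial>lborel) = ennreal (2 * pi)"
    by (rule nn_integral_has_integral_lebesgue'[OF _ poisson_kernel_has_integral[OF z]]) (use z2 in auto)
  then show ?thesis
    by (subst nn_integral_circle_measure) (auto intro!: measurable_restrict_space1)
qed

section \<open>Almost everywhere differentiability of Lipschitz functions\<close>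

text \<open>Meant for the disjoint balls of a Vitali cover. Since \<open>g\<close> may change sign,
  the passage from finite unions to the whole union rests on integrability over the union, not on
  monotonicity.\<close>

lemma set_integral_nonneg_countable_Union:
  fixes g :: "'a \<Rightarrow> real"
  assumes C: "countable C" and disj: "disjoint_family_on A C"
    and meas: "\<And>i. i \<in> C \<Longrightarrow> A i \<in> sets M"
    and int: "set_integrable M (\<Union>i\<in>C. A i) g"
    and nonneg: "\<And>i. i \<in> C \<Longrightarrow> 0 \<le> (LINT x:A i|M. g x)"
  shows "0 \<le> (LINT x:(\<Union>i\<in>C. A i)|M. g x)"
proof (cases "C = {}")
  case True
  then show ?thesis by (simp add: set_lebesgue_integral_def)
next
  case False
  define B where "B n = (if n \<in> to_nat_on C ` C then A (from_nat_into C n) else {})" for n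
  have U: "(\<Union>i\<in>C. A i) = (\<Union>n. B n)"
  proof -
    have "A i = B (to_nat_on C i)" if "i \<in> C" for i
      using that C by (auto simp: B_def)
    moreover have "B n = {} \<or> (\<exists>i\<in>C. B n = A i)" for n
      using from_nat_into[OF False, of n] by (auto simp: B_def)
    ultimately show ?thesis by blast
  qed
  have Bm: "B n \<in> sets M" for n
    using meas from_nat_into[OF False, of n] by (auto simp: B_def)
  have Bd: "disjoint_family B"
  proof (unfold disjoint_family_on_def, intro ballI impI)
    fix m n :: nat assume mn: "m \<noteq> n"
    show "B m \<inter> B n = {}"
    proof (cases "m \<in> to_nat_on C ` C \<and> n \<in> to_nat_on C ` C")
      case True
      then obtain i j where ij: "i \<in> C" "j \<in> C" "m = to_nat_on C i" "n = to_nat_on C j" by blast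
      then have "i \<noteq> j" using mn by auto
      then show ?thesis using ij disj C by (auto simp: B_def disjoint_family_on_def)
    qed (auto simp: B_def)
  qed
  have Bnn: "0 \<le> (LINT x:B n|M. g x)" for n
  proof (cases "n \<in> to_nat_on C ` C")
    case True
    then show ?thesis using nonneg from_nat_into[OF False, of n] by (auto simp: B_def)
  qed (simp add: B_def set_lebesgue_integral_def)
  have part: "0 \<le> (LINT x:(\<Union>k<n. B k)|M. g x)" for n
  proof -
    have "(LINT x:(\<Union>k\<in>{..<n}. B k)|M. g x) = (\<Sum>k\<in>{..<n}. (LINT x:B k|M. g x))"
    proof (rule set_integral_finite_Union)
      show "set_integrable M (B k) g" for k
        by (rule set_integrable_subset[OF int]) (use Bm U in auto)
    qed (use Bm Bd in \<open>auto simp: disjoint_family_on_def\<close>)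
    then show ?thesis using Bnn by (simp add: sum_nonneg)
  qed
  have "(\<lambda>n. LINT x:(\<Union>k<n. B k)|M. g x) \<longlonglongrightarrow> (LINT x:(\<Union>n. \<Union>k<n. B k)|M. g x)"
  proof (rule set_integral_cont_up)
    have "(\<Union>n. \<Union>k<n. B k) = (\<Union>n. B n)" by blast
    then show "set_integrable M (\<Union>n. \<Union>k<n. B k) g" using int U by simp
  qed (use Bm in \<open>fastforce simp: incseq_def\<close>)+
  moreover have "(\<Union>n. \<Union>k<n. B k) = (\<Union>i\<in>C. A i)" unfolding U by blast
  ultimately show ?thesis using part by (intro LIMSEQ_le_const[where a=0]) auto
qed

text \<open>Vitali's theorem covers almost all of \<open>E\<close> by disjoint intervals on which
  \<open>g\<close> has average at least \<open>q\<close>, all inside an open set barely larger than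
  a set where \<open>g \<le> q'\<close>. Integrating \<open>g\<close> over their union
  \<open>W\<close> gives \<open>q * |W| \<le> q' * |W|\<close> up to a small error, so
  \<open>|W|\<close> is small.\<close>

lemma negligible_upper_density:
  fixes g :: "real \<Rightarrow> real"
  assumes g[measurable]: "g \<in> borel_measurable borel"
    and int: "\<And>a b. set_integrable lborel {a..b} g"
    and qq: "q' < q"
    and le: "\<And>x. x \<in> E \<Longrightarrow> g x \<le> q'"
    and bad: "\<And>x d. x \<in> E \<Longrightarrow> 0 < d \<Longrightarrow>
       \<exists>a b. a \<le> x \<and> x \<le> b \<and> a < b \<and> b - a < d \<and> q * (b - a) \<le> (LINT y:{a..b}|lborel. g y)"
  shows "negligible E"
proof -
  have neg: "negligible (E \<inter> {-real N<..<real N})" for N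
  proof -
    let ?J = "{-real N<..<real N}"
    \<comment> \<open>\<open>E\<close> need not be measurable. \<open>A\<close> is a Borel set that
      contains \<open>E \<inter> ?J\<close> and still has \<open>g \<le> q'\<close>.\<close>
    define A where "A = {x. g x \<le> q'} \<inter> ?J"
    have A[measurable]: "A \<in> sets borel" unfolding A_def by measurable
    \<comment> \<open>The weight \<open>1 + |g|\<close> lets one finite measure control both the
      length of a set and the integral of \<open>|g|\<close> over it. Outer regularity of
      \<open>\<rho>\<close> then supplies the open set.\<close>
    define \<rho> where "\<rho> = density lborel (\<lambda>x. indicator ?J x * ennreal (1 + \<bar>g x\<bar>))"
    have intJ: "set_integrable lborel ?J g"
      by (rule set_integrable_subset[OF int[of "-real N" "real N"]]) auto
    have intJ1: "set_integrable lborel ?J (\<lambda>x. 1 + \<bar>g x\<bar>)"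
      by (intro set_integral_add set_integrable_abs intJ) (simp add: set_integrable_def)
    have rho_eq: "emeasure \<rho> B = ennreal (LINT x:B \<inter> ?J|lborel. 1 + \<bar>g x\<bar>)" if [measurable]: "B \<in> sets borel" for B
    proof -
      have "emeasure \<rho> B = (\<integral>\<^sup>+x. ennreal (indicator (B \<inter> ?J) x *\<^sub>R (1 + \<bar>g x\<bar>)) \<partial>lborel)"
        unfolding \<rho>_def by (subst emeasure_density) (auto intro!: nn_integral_cong split: split_indicator)
      also have "\<dots> = ennreal (LINT x:B \<inter> ?J|lborel. 1 + \<bar>g x\<bar>)"
        unfolding set_lebesgue_integral_def
        by (rule nn_integral_eq_integral)
           (use set_integrable_subset[OF intJ1, of "B \<inter> ?J"] in \<open>auto simp: set_integrable_def split: split_indicator\<close>)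
      finally show ?thesis .
    qed
    have fin: "emeasure \<rho> (space \<rho>) \<noteq> \<infinity>"
      using rho_eq[of UNIV] by (simp add: \<rho>_def)
    show ?thesis
    proof (rule negligible_outer_le[THEN iffD2], intro allI impI)
      fix e :: real assume e: "0 < e"
      \<comment> \<open>Chosen so that the final error \<open>(1 + |q'|) * \<epsilon>\<close> equals
        \<open>e * (q - q')\<close>.\<close>
      define \<epsilon> where "\<epsilon> = e * (q - q') / (1 + \<bar>q'\<bar>)"
      have eps: "0 < \<epsilon>" using e qq by (simp add: \<epsilon>_def)
      have "emeasure \<rho> A < emeasure \<rho> A + ennreal \<epsilon>"
        using fin eps by (metis A ennreal_add_left_cancel_less add.right_neutral ennreal_less_zero_iff rho_eq
              ennreal_less_top infinity_ennreal_def top.not_eq_extremum)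
      moreover have "emeasure \<rho> A = (INF U \<in> {U. A \<subseteq> U \<and> open U}. emeasure \<rho> U)"
        by (rule outer_regular) (use fin A in \<open>auto simp: \<rho>_def\<close>)
      ultimately obtain U where U: "A \<subseteq> U" "open U" "emeasure \<rho> U < emeasure \<rho> A + ennreal \<epsilon>"
        by (metis (no_types, lifting) INF_less_iff mem_Collect_eq)
      define O' where "O' = U \<inter> ?J"
      have O': "open O'" "A \<subseteq> O'" "O' \<subseteq> ?J" using U by (auto simp: O'_def A_def)
      have [measurable]: "O' \<in> sets borel" "U \<in> sets borel" using O' U by auto
      \<comment> \<open>The Vitali family, indexed by centre and radius. An interval
        \<open>{a..b}\<close> supplied by \<open>bad\<close> contains \<open>x\<close> without being
        centred there; the covering theorem only asks that \<open>x\<close> lie in the ball.\<close>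
      define K where "K = {(c, r). 0 < r \<and> cball c r \<subseteq> O' \<and> q * (2 * r) \<le> (LINT y:cball c r|lborel. g y)}"
      have "\<exists>i. i \<in> K \<and> x \<in> cball (fst i) (snd i) \<and> snd i < d"
        if x: "x \<in> E \<inter> ?J" and d: "0 < d" for x d
      proof -
        have "x \<in> A" using x le by (auto simp: A_def)
        then obtain \<eta> where \<eta>: "\<eta> > 0" "ball x \<eta> \<subseteq> O'"
          using O' by (meson open_contains_ball subsetD)
        obtain a b where ab: "a \<le> x" "x \<le> b" "a < b" "b - a < min d \<eta>"
            "q * (b - a) \<le> (LINT y:{a..b}|lborel. g y)"
          using bad[of x "min d \<eta>"] x d \<eta> by auto
        have cb: "cball ((a+b)/2) ((b-a)/2) = {a..b}"
          by (auto simp: cball_def dist_real_def abs_if field_simps split: if_splits)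
        have "{a..b} \<subseteq> ball x \<eta>"
        proof
          fix y assume "y \<in> {a..b}"
          then have "\<bar>x - y\<bar> \<le> b - a" using ab(1,2) by (simp add: abs_le_iff)
          then show "y \<in> ball x \<eta>" using ab(4) by (simp add: dist_real_def)
        qed
        then have "cball ((a+b)/2) ((b-a)/2) \<subseteq> O'" using \<eta>(2) unfolding cb by (rule subset_trans)
        moreover have "q * (2 * ((b-a)/2)) \<le> (LINT y:cball ((a+b)/2) ((b-a)/2)|lborel. g y)"
          unfolding cb using ab(5) by (simp only: nonzero_mult_div_cancel_left times_divide_eq_right)
        ultimately have "((a+b)/2, (b-a)/2) \<in> K" unfolding K_def using ab(3) by simp
        moreover have "x \<in> cball ((a+b)/2) ((b-a)/2)" unfolding cb using ab by simp
        moreover have "(b-a)/2 < d" using ab(3,4) by simp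
        ultimately show ?thesis by (intro exI[of _ "((a+b)/2, (b-a)/2)"]) simp
      qed
      moreover have "0 < snd i" if "i \<in> K" for i using that by (auto simp: K_def)
      ultimately obtain C where C: "countable C" "C \<subseteq> K"
        "pairwise (\<lambda>i j. disjnt (cball (fst i) (snd i)) (cball (fst j) (snd j))) C"
        "negligible (E \<inter> ?J - (\<Union>i\<in>C. cball (fst i) (snd i)))"
        using Vitali_covering_theorem_cballs[of K snd "E \<inter> ?J" fst thesis] by blast
      define W where "W = (\<Union>i\<in>C. cball (fst i) (snd i))"
      have WO: "W \<subseteq> O'"
      proof -
        have "cball (fst i) (snd i) \<subseteq> O'" if "i \<in> C" for i
          using subsetD[OF C(2) that] unfolding K_def by (simp add: case_prod_beta)
        then show ?thesis by (auto simp only: W_def)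
      qed
      have [measurable]: "W \<in> sets borel"
        unfolding W_def using C(1) by (intro sets.countable_UN') auto
      have WJ: "W \<subseteq> ?J" using WO O' by blast
      have Wfin: "emeasure lborel B < \<infinity>" if "B \<subseteq> ?J" for B
      proof -
        have "emeasure lborel B \<le> emeasure lborel ?J" by (rule emeasure_mono) (use that in auto)
        also have "\<dots> < \<infinity>" by simp
        finally show ?thesis .
      qed
      have const: "set_integrable lborel B (\<lambda>x. c)" if "B \<in> sets borel" "B \<subseteq> ?J" for B and c::real
        using that Wfin[OF that(2)] by (auto simp: set_integrable_def)
      have constI: "(LINT x:B|lborel. c) = measure lborel B * c" if "B \<in> sets borel" "B \<subseteq> ?J" for B and c::real
        using that Wfin[OF that(2)] unfolding set_lebesgue_integral_def by simp
      have intW: "set_integrable lborel B g" if "B \<in> sets borel" "B \<subseteq> ?J" for B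
        by (rule set_integrable_subset[OF intJ]) (use that in auto)
      have "0 \<le> (LINT x:(\<Union>i\<in>C. cball (fst i) (snd i))|lborel. g x - q)"
      proof (rule set_integral_nonneg_countable_Union)
        show "set_integrable lborel (\<Union>i\<in>C. cball (fst i) (snd i)) (\<lambda>x. g x - q)"
          unfolding W_def[symmetric] by (intro set_integral_diff intW const WJ) auto
        fix i assume "i \<in> C"
        then have i: "0 < snd i" "cball (fst i) (snd i) \<subseteq> O'"
          "q * (2 * snd i) \<le> (LINT y:cball (fst i) (snd i)|lborel. g y)"
          using subsetD[OF C(2) \<open>i \<in> C\<close>] unfolding K_def by (simp_all add: case_prod_beta)
        have sub: "cball (fst i) (snd i) \<subseteq> ?J" using i(2) O'(3) by (rule subset_trans)
        have "measure lborel (cball (fst i) (snd i)) = 2 * snd i"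
          using i by (simp add: cball_eq_atLeastAtMost)
        then show "0 \<le> (LINT x:cball (fst i) (snd i)|lborel. g x - q)"
          using i(1,3) sub by (subst set_integral_diff) (auto intro!: intW const simp: constI mult.commute)
      qed (use C in \<open>auto simp: disjoint_family_on_def pairwise_def disjnt_def\<close>)
      then have "0 \<le> (LINT x:W|lborel. g x - q)" by (simp add: W_def)
      then have 1: "q * measure lborel W \<le> (LINT x:W|lborel. g x)"
        using WJ by (subst (asm) set_integral_diff) (auto intro!: intW const simp: constI mult.commute)
      have intW': "set_integrable lborel W (\<lambda>x. indicator (O' - A) x * ((1 + \<bar>q'\<bar>) * (1 + \<bar>g x\<bar>)))"
      proof -
        have "set_integrable lborel W (\<lambda>x. (1 + \<bar>q'\<bar>) * (1 + \<bar>g x\<bar>))"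
          by (rule set_integrable_mult_right, rule set_integrable_subset[OF intJ1]) (use WJ in auto)
        then have "set_integrable lborel (W \<inter> (O' - A)) (\<lambda>x. (1 + \<bar>q'\<bar>) * (1 + \<bar>g x\<bar>))"
          by (rule set_integrable_subset) auto
        then show ?thesis
          unfolding set_integrable_def by (simp add: indicator_inter_arith mult_ac)
      qed
      \<comment> \<open>On \<open>A\<close> the bound is \<open>g \<le> q'\<close>. Elsewhere in
        \<open>W\<close> it holds because
        \<open>g - q' \<le> |g| + |q'| \<le> (1 + |q'|) * (1 + |g|)\<close>.\<close>
      have "(LINT x:W|lborel. g x) \<le> (LINT x:W|lborel. q' + indicator (O' - A) x * ((1 + \<bar>q'\<bar>) * (1 + \<bar>g x\<bar>)))"
      proof (rule set_integral_mono)
        show "set_integrable lborel W g" using WJ by (intro intW) auto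
        show "set_integrable lborel W (\<lambda>x. q' + indicator (O' - A) x * ((1 + \<bar>q'\<bar>) * (1 + \<bar>g x\<bar>)))"
          by (intro set_integral_add const WJ intW') auto
        fix x assume x: "x \<in> W"
        show "g x \<le> q' + indicator (O' - A) x * ((1 + \<bar>q'\<bar>) * (1 + \<bar>g x\<bar>))"
        proof (cases "x \<in> A")
          case False
          have "0 \<le> \<bar>q'\<bar> * \<bar>g x\<bar>" by simp
          moreover have "g x \<le> \<bar>g x\<bar>" "-q' \<le> \<bar>q'\<bar>" by auto
          moreover have ind: "indicator (O' - A) x = (1::real)" using False x WO by auto
          moreover have "(1 + \<bar>q'\<bar>) * (1 + \<bar>g x\<bar>) = 1 + \<bar>q'\<bar> + \<bar>g x\<bar> + \<bar>q'\<bar> * \<bar>g x\<bar>"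
            by (simp add: algebra_simps)
          ultimately show ?thesis unfolding ind by linarith
        qed (simp add: A_def)
      qed
      also have "\<dots> = q' * measure lborel W + (LINT x:W|lborel. indicator (O' - A) x * ((1 + \<bar>q'\<bar>) * (1 + \<bar>g x\<bar>)))"
        using WJ intW' by (subst set_integral_add) (auto intro!: const simp: constI mult.commute)
      also have "(LINT x:W|lborel. indicator (O' - A) x * ((1 + \<bar>q'\<bar>) * (1 + \<bar>g x\<bar>)))
          = (1 + \<bar>q'\<bar>) * (LINT x:W \<inter> (O' - A)|lborel. 1 + \<bar>g x\<bar>)"
        unfolding set_lebesgue_integral_def
        by (subst integral_mult_right_zero[symmetric], rule Bochner_Integration.integral_cong)
           (simp_all split: split_indicator)
      also have "\<dots> \<le> (1 + \<bar>q'\<bar>) * \<epsilon>"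
      proof (rule mult_left_mono)
        have "emeasure \<rho> A + emeasure \<rho> (O' - A) = emeasure \<rho> (A \<union> (O' - A))"
          by (rule plus_emeasure) (auto simp: \<rho>_def)
        also have "\<dots> \<le> emeasure \<rho> U"
          by (rule emeasure_mono) (use O' in \<open>auto simp: \<rho>_def O'_def\<close>)
        also have "\<dots> < emeasure \<rho> A + ennreal \<epsilon>" by (rule U)
        finally have "emeasure \<rho> (O' - A) < ennreal \<epsilon>"
          by (simp add: ennreal_add_left_cancel_less)
        then have *: "(LINT x:(O' - A) \<inter> ?J|lborel. 1 + \<bar>g x\<bar>) < \<epsilon>"
          by (simp add: rho_eq) (metis ennreal_leI linorder_not_le)
        have "(LINT x:W \<inter> (O' - A)|lborel. 1 + \<bar>g x\<bar>) \<le> (LINT x:(O' - A) \<inter> ?J|lborel. 1 + \<bar>g x\<bar>)"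
          unfolding set_lebesgue_integral_def
          by (rule integral_mono; (fold set_integrable_def, rule set_integrable_subset[OF intJ1])?)
             (use WJ in \<open>auto split: split_indicator\<close>)
        then show "(LINT x:W \<inter> (O' - A)|lborel. 1 + \<bar>g x\<bar>) \<le> \<epsilon>" using * by simp
      qed simp
      finally have "q * measure lborel W \<le> q' * measure lborel W + (1 + \<bar>q'\<bar>) * \<epsilon>"
        using 1 by simp
      moreover have "(1 + \<bar>q'\<bar>) * \<epsilon> = e * (q - q')" by (simp add: \<epsilon>_def)
      ultimately have "(q - q') * measure lborel W \<le> (q - q') * e" by (simp add: algebra_simps)
      then have me: "measure lborel W \<le> e" using qq by simp
      let ?N = "E \<inter> ?J - W"
      have N: "negligible ?N" using C(4) by (simp add: W_def)
      then have Nm: "?N \<in> lmeasurable" by (rule negligible_imp_measurable)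
      have Wm: "W \<in> lmeasurable" using Wfin[OF WJ] by (auto intro!: fmeasurableI)
      have "measure lebesgue (W \<union> ?N) \<le> measure lebesgue W + measure lebesgue ?N"
        using Wm Nm by (intro measure_Un_le) auto
      also have "\<dots> \<le> e" using me N by (simp add: negligible_imp_measure0)
      finally show "\<exists>T. E \<inter> ?J \<subseteq> T \<and> T \<in> lmeasurable \<and> measure lebesgue T \<le> e"
        using fmeasurable.Un[OF Wm Nm] by (intro exI[of _ "W \<union> ?N"] conjI) auto
    qed
  qed
  have "E = (\<Union>N. E \<inter> {-real N<..<real N})"
  proof (intro equalityI subsetI)
    fix x assume "x \<in> E"
    moreover obtain N :: nat where "\<bar>x\<bar> < real N" using reals_Archimedean2 by blast
    ultimately have "x \<in> E \<inter> {-real N<..<real N}" by (auto simp: abs_less_iff)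
    then show "x \<in> (\<Union>N. E \<inter> {-real N<..<real N})" by blast
  qed auto
  moreover have "negligible (\<Union>N::nat. E \<inter> {-real N<..<real N})"
    using neg by (intro negligible_countable_Union) auto
  ultimately show ?thesis by simp
qed

text \<open>If the difference quotients do not tend to \<open>g x\<close>, then for a sign
  \<open>s\<close> some arbitrarily short intervals around \<open>x\<close> have average of
  \<open>s * g\<close> at least \<open>q\<close>, with rationals \<open>q' < q\<close> and
  \<open>s * g x \<le> q'\<close>. The sign \<open>1\<close> treats the upper derivates and
  \<open>-1\<close> the lower ones. The rational pairs make this a countable union of sets covered
  by the density lemma. Intervals with \<open>x\<close> as an endpoint are allowed, which yields
  both one-sided limits.\<close>

lemma negligible_not_derivative_indefinite_integral:
  fixes g U :: "real \<Rightarrow> real"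
  assumes g[measurable]: "g \<in> borel_measurable borel"
    and int: "\<And>a b. set_integrable lborel {a..b} g"
    and U: "\<And>x y. x \<le> y \<Longrightarrow> U y - U x = (LINT t:{x..y}|lborel. g t)"
  shows "negligible {x. \<not> (U has_real_derivative g x) (at x)}"
proof -
  define P where "P s q' q = {x. s * g x \<le> q' \<and>
     (\<forall>d>0. \<exists>a b. a \<le> x \<and> x \<le> b \<and> a < b \<and> b - a < d \<and> q * (b - a) \<le> s * (U b - U a))}" for s q' q :: real
  have P: "negligible (P s q' q)" if "q' < q" for s q' q :: real
  proof (rule negligible_upper_density[where g="\<lambda>x. s * g x" and q=q and q'=q'])
    show "set_integrable lborel {a..b} (\<lambda>x. s * g x)" for a b
      by (intro set_integrable_mult_right int)
    fix x d :: real assume x: "x \<in> P s q' q" "0 < d"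
    then obtain a b where ab: "a \<le> x" "x \<le> b" "a < b" "b - a < d" "q * (b - a) \<le> s * (U b - U a)"
      unfolding P_def by blast
    then show "\<exists>a b. a \<le> x \<and> x \<le> b \<and> a < b \<and> b - a < d \<and> q * (b - a) \<le> (LINT y:{a..b}|lborel. s * g y)"
      by (intro exI[of _ a] exI[of _ b]) (simp add: U)
  qed (use that in \<open>auto simp: P_def\<close>)
  have good: "\<exists>d>0. \<forall>a b. a \<le> x \<and> x \<le> b \<and> a < b \<and> b - a < d \<longrightarrow> s * (U b - U a) < (s * g x + e) * (b - a)"
    if x: "x \<notin> (\<Union>q'\<in>\<rat>. \<Union>q\<in>{q\<in>\<rat>. q' < q}. P s q' q)" and e: "0 < e" for s x e
  proof -
    obtain q' where q': "q' \<in> \<rat>" "s * g x < q'" "q' < s * g x + e"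
      using Rats_dense_in_real[of "s * g x" "s * g x + e"] e by auto
    obtain q where q: "q \<in> \<rat>" "q' < q" "q < s * g x + e"
      using Rats_dense_in_real[of q' "s * g x + e"] q' by auto
    have "x \<notin> P s q' q" using x q q' by blast
    then have "\<not> (\<forall>d>0. \<exists>a b. a \<le> x \<and> x \<le> b \<and> a < b \<and> b - a < d \<and> q * (b - a) \<le> s * (U b - U a))"
      using less_imp_le[OF q'(2)] unfolding P_def by (simp only: mem_Collect_eq simp_thms)
    then obtain d where d: "d > 0"
      "\<not> (\<exists>a b. a \<le> x \<and> x \<le> b \<and> a < b \<and> b - a < d \<and> q * (b - a) \<le> s * (U b - U a))"
      by blast
    have "s * (U b - U a) < (s * g x + e) * (b - a)" if "a \<le> x" "x \<le> b" "a < b" "b - a < d" for a b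
    proof -
      have "s * (U b - U a) < q * (b - a)" using d(2) that by (meson not_le)
      also have "\<dots> \<le> (s * g x + e) * (b - a)" using that q by (intro mult_right_mono) auto
      finally show ?thesis .
    qed
    then show ?thesis using d(1) by blast
  qed
  have "{x. \<not> (U has_real_derivative g x) (at x)} \<subseteq>
     (\<Union>s\<in>{1,-1}. \<Union>q'\<in>\<rat>. \<Union>q\<in>{q\<in>\<rat>. q' < q}. P s q' q)"
  proof (rule subsetI, rule ccontr)
    fix x assume "x \<in> {x. \<not> (U has_real_derivative g x) (at x)}"
      and nx: "x \<notin> (\<Union>s\<in>{1,-1}. \<Union>q'\<in>\<rat>. \<Union>q\<in>{q\<in>\<rat>. q' < q}. P s q' q)"
    have "((\<lambda>y. (U y - U x) / (y - x)) \<longlongrightarrow> g x) (at x)"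
    proof (rule tendstoI)
      fix e :: real assume e: "0 < e"
      obtain d1 where d1: "d1 > 0" "\<And>a b. a \<le> x \<Longrightarrow> x \<le> b \<Longrightarrow> a < b \<Longrightarrow> b - a < d1 \<Longrightarrow> U b - U a < (g x + e) * (b - a)"
        using good[of x 1 e] nx e by auto
      obtain d2 where d2: "d2 > 0" "\<And>a b. a \<le> x \<Longrightarrow> x \<le> b \<Longrightarrow> a < b \<Longrightarrow> b - a < d2 \<Longrightarrow> - (U b - U a) < (- g x + e) * (b - a)"
        using good[of x "-1" e] nx e by auto
      have key: "\<bar>U b - U a - g x * (b - a)\<bar> < e * (b - a)"
        if "a \<le> x" "x \<le> b" "a < b" "b - a < min d1 d2" for a b
        using d1(2)[of a b] d2(2)[of a b] that by (simp add: algebra_simps abs_less_iff)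
      have "\<bar>(U y - U x) / (y - x) - g x\<bar> < e" if y: "y \<noteq> x" "\<bar>y - x\<bar> < min d1 d2" for y
      proof -
        have "\<bar>U y - U x - g x * (y - x)\<bar> < e * \<bar>y - x\<bar>"
        proof (cases "x < y")
          case True
          then show ?thesis using key[of x y] y by simp
        next
          case False
          then have "\<bar>U x - U y - g x * (x - y)\<bar> < e * (x - y)" using key[of y x] y by simp
          moreover have "U x - U y - g x * (x - y) = - (U y - U x - g x * (y - x))" by (simp add: algebra_simps)
          moreover have "\<bar>y - x\<bar> = x - y" using False by simp
          ultimately show ?thesis by (metis abs_minus_cancel)
        qed
        moreover have "(U y - U x) / (y - x) - g x = (U y - U x - g x * (y - x)) / (y - x)"
          using y by (simp add: field_simps)
        ultimately show ?thesis using y by (simp add: abs_divide pos_divide_less_eq)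
      qed
      then show "\<forall>\<^sub>F y in at x. dist ((U y - U x) / (y - x)) (g x) < e"
        unfolding eventually_at dist_real_def using d1(1) d2(1) by (intro exI[of _ "min d1 d2"]) auto
    qed
    then show False using \<open>x \<in> _\<close> by (simp add: has_field_derivative_iff)
  qed
  moreover have "negligible (\<Union>s\<in>{1,-1}. \<Union>q'\<in>\<rat>. \<Union>q\<in>{q\<in>\<rat>. q' < q}. P s q' q)"
  proof -
    have "countable {q\<in>\<rat>. q' < q}" for q' :: real
      by (rule countable_subset[OF _ countable_rat]) auto
    then have "negligible (\<Union>q\<in>{q\<in>\<rat>. q' < q}. P s q' q)" for s q'
      using P by (intro negligible_countable_Union countable_image) auto
    then have "negligible (\<Union>q'\<in>\<rat>. \<Union>q\<in>{q\<in>\<rat>. q' < q}. P s q' q)" for s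
      by (intro negligible_countable_Union countable_image countable_rat) auto
    then show ?thesis by (intro negligible_countable_Union countable_image) auto
  qed
  ultimately show ?thesis by (rule negligible_subset[rotated])
qed

text \<open>Adding a steep linear function makes \<open>u\<close> an increasing bijection
  \<open>U\<close> with Lipschitz inverse. Its Stieltjes measure is absolutely continuous, so
  \<open>U\<close> is the indefinite integral of a Radon-Nikodym density, and differentiability of
  \<open>U\<close> passes back to \<open>u\<close>.\<close>

lemma negligible_not_differentiable_Lipschitz:
  fixes u :: "real \<Rightarrow> real"
  assumes u: "K-lipschitz_on UNIV u"
  shows "negligible {x. \<not> u differentiable (at x)}"
proof -
  have K: "0 \<le> K" using u by (rule lipschitz_on_nonneg)
  \<comment> \<open>The slope \<open>K + 1\<close> exceeds the Lipschitz constant by 1, so all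
    difference quotients of \<open>U\<close> lie between 1 and \<open>2 * K + 1\<close>.\<close>
  define U where "U x = u x + (K + 1) * x" for x
  have U_lower: "y - x \<le> U y - U x" if "x \<le> y" for x y
  proof -
    have "\<bar>u x - u y\<bar> \<le> K * (y - x)" using lipschitz_onD[OF u, of x y] that by (simp add: dist_real_def)
    then have "- (K * (y - x)) \<le> u y - u x" by linarith
    then show ?thesis by (simp add: U_def algebra_simps)
  qed
  have U_upper: "\<bar>U y - U x\<bar> \<le> (2 * K + 1) * \<bar>y - x\<bar>" for x y
  proof -
    have "U y - U x = (u y - u x) + (K + 1) * (y - x)" by (simp add: U_def algebra_simps)
    then have "\<bar>U y - U x\<bar> \<le> \<bar>u y - u x\<bar> + \<bar>(K + 1) * (y - x)\<bar>" by (metis abs_triangle_ineq)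
    also have "\<dots> \<le> K * \<bar>y - x\<bar> + (K + 1) * \<bar>y - x\<bar>"
      using lipschitz_onD[OF u, of y x] K by (simp add: dist_real_def abs_mult)
    finally show ?thesis by (simp add: algebra_simps)
  qed
  have mono: "strict_mono U"
  proof (rule strict_monoI)
    fix x y :: real assume "x < y"
    then show "U x < U y" using U_lower[of x y] by simp
  qed
  then have inj: "inj U" by (rule strict_mono_imp_inj_on)
  have lip: "(2 * K + 1)-lipschitz_on UNIV U"
    using U_upper K by (intro lipschitz_onI) (auto simp: dist_real_def abs_minus_commute)
  then have contU: "continuous_on UNIV U" by (rule lipschitz_on_continuous_on)
  have surj: "surj U"
  proof (rule surjI[where f="\<lambda>y. SOME x. U x = y"], rule someI_ex)
    fix y
    define c where "c = \<bar>y - U 0\<bar>"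
    have "U (-c) \<le> y" "y \<le> U c" using U_lower[of "-c" 0] U_lower[of 0 c] by (auto simp: c_def)
    moreover have "-c \<le> c" by (simp add: c_def)
    ultimately show "\<exists>x. U x = y"
      using IVT'[of U "-c" y c] contU by (auto intro: continuous_on_subset)
  qed
  define w where "w = inv U"
  have Uw[simp]: "U (w y) = y" and wU[simp]: "w (U x) = x" for x y
    using surj inj by (auto simp: w_def surj_f_inv_f)
  have w_mono: "mono w"
  proof (rule monoI)
    fix a b :: real assume "a \<le> b"
    then show "w a \<le> w b" using strict_mono_less_eq[OF mono, of "w a" "w b"] by simp
  qed
  have w[measurable]: "w \<in> borel_measurable borel" by (rule borel_measurable_mono[OF w_mono])
  have vimage: "w -` A = U ` A" for A
  proof
    show "w -` A \<subseteq> U ` A"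
    proof
      fix y assume "y \<in> w -` A"
      then have "U (w y) \<in> U ` A" by blast
      then show "y \<in> U ` A" by simp
    qed
  qed auto
  \<comment> \<open>\<open>L\<close> is the Stieltjes measure of the bi-Lipschitz function \<open>U\<close>, obtained without a
    Caratheodory construction; its density is the derivative of \<open>U\<close>.\<close>
  define L where "L = distr lborel borel w"
  have ac: "absolutely_continuous lborel L"
    unfolding absolutely_continuous_def
  proof
    fix N :: "real set" assume N: "N \<in> null_sets lborel"
    then have "negligible N" by (simp add: negligible_iff_null_sets null_sets_completionI)
    \<comment> \<open>Lipschitz maps send null sets to null sets. As \<open>w -\<close> N = U
      \<open>N\<close>, this is exactly absolute continuity of the pushforward under
      \<open>w\<close>.\<close>
    then have "negligible (U ` N)"
      by (rule negligible_locally_Lipschitz_image[rotated])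
         (use U_upper in \<open>auto intro!: exI[of _ UNIV] exI[of _ "2*K+1"] simp: abs_minus_commute\<close>)
    moreover have [measurable]: "N \<in> sets borel" using N by auto
    moreover have "U ` N \<in> sets borel" using measurable_sets[OF w, of N] by (simp add: vimage)
    ultimately have "emeasure lborel (U ` N) = 0"
      by (simp add: negligible_iff_emeasure0)
    then show "N \<in> null_sets L"
      by (auto simp: L_def null_sets_def emeasure_distr vimage)
  qed
  have "sets L = sets lborel" by (simp add: L_def)
  then obtain f where f[measurable]: "f \<in> borel_measurable lborel" and fL: "density lborel f = L"
    using sigma_finite_measure.Radon_Nikodym[OF lborel.sigma_finite_measure_axioms ac] by blast
  have interval: "(\<integral>\<^sup>+t\<in>{x..y}. f t \<partial>lborel) = ennreal (U y - U x)" if "x \<le> y" for x y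
  proof -
    have "(\<integral>\<^sup>+t\<in>{x..y}. f t \<partial>lborel) = emeasure L {x..y}" by (simp add: fL[symmetric] emeasure_density)
    also have "\<dots> = emeasure lborel (w -` {x..y})" by (simp add: L_def emeasure_distr)
    also have "w -` {x..y} = {U x..U y}"
    proof -
      have "x \<le> w t \<longleftrightarrow> U x \<le> t" "w t \<le> y \<longleftrightarrow> t \<le> U y" for t
        using strict_mono_less_eq[OF mono, of x "w t"] strict_mono_less_eq[OF mono, of "w t" y] by simp_all
      then show ?thesis by auto
    qed
    also have "emeasure lborel \<dots> = ennreal (U y - U x)"
      using that mono by (simp add: strict_mono_less_eq)
    finally show ?thesis .
  qed
  \<comment> \<open>A real-valued representative of the density: \<open>f\<close> has finite
    integral over bounded intervals, hence is finite almost everywhere, and \<open>enn2real\<close>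
    alters it only on a null set.\<close>
  define g where "g t = enn2real (f t)" for t
  have g[measurable]: "g \<in> borel_measurable borel" unfolding g_def by measurable
  have ffin: "AE t in lborel. f t \<noteq> \<infinity>"
  proof -
    have "AE t in lborel. t \<in> {- real n..real n} \<longrightarrow> f t \<noteq> \<infinity>" for n
    proof -
      have "AE t in lborel. f t * indicator {- real n..real n} t \<noteq> \<infinity>"
        by (rule nn_integral_PInf_AE) (use interval[of "- real n" "real n"] in auto)
      then show ?thesis by eventually_elim (auto simp: indicator_def)
    qed
    then have "AE t in lborel. \<forall>n. t \<in> {- real n..real n} \<longrightarrow> f t \<noteq> \<infinity>"
      by (subst AE_all_countable) blast
    then show ?thesis
    proof eventually_elim
      case (elim t)
      obtain n where "\<bar>t\<bar> < real n" using reals_Archimedean2 by blast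
      then have "t \<in> {- real n..real n}" by auto
      then show ?case using elim by blast
    qed
  qed
  have gint: "(\<integral>\<^sup>+t. ennreal (indicator {x..y} t *\<^sub>R g t) \<partial>lborel) = ennreal (U y - U x)" if "x \<le> y" for x y
  proof -
    have "(\<integral>\<^sup>+t. ennreal (indicator {x..y} t *\<^sub>R g t) \<partial>lborel) = (\<integral>\<^sup>+t\<in>{x..y}. f t \<partial>lborel)"
      by (rule nn_integral_cong_AE, use ffin in eventually_elim)
         (auto simp: g_def indicator_def top.not_eq_extremum)
    then show ?thesis using interval[OF that] by simp
  qed
  have hbi: "has_bochner_integral lborel (\<lambda>t. indicator {x..y} t *\<^sub>R g t) (U y - U x)" if "x \<le> y" for x y
    by (rule has_bochner_integral_nn_integral[OF _ _ _ gint])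
       (use that mono in \<open>auto simp: g_def strict_mono_less_eq\<close>)
  have "negligible {x. \<not> (U has_real_derivative g x) (at x)}"
  proof (rule negligible_not_derivative_indefinite_integral[OF g])
    show "set_integrable lborel {a..b} g" for a b
    proof (cases "a \<le> b")
      case True
      then show ?thesis using hbi by (auto simp: set_integrable_def has_bochner_integral_iff)
    qed (simp add: set_integrable_def)
    show "U y - U x = (LINT t:{x..y}|lborel. g t)" if "x \<le> y" for x y
      using hbi[OF that] by (auto simp: set_lebesgue_integral_def has_bochner_integral_iff)
  qed
  moreover have "u differentiable (at x)" if d: "(U has_real_derivative g x) (at x)" for x
  proof -
    have "((\<lambda>x. U x - (K + 1) * x) has_real_derivative (g x - (K + 1))) (at x)"
      by (rule derivative_eq_intros d refl | simp)+
    then have "(u has_real_derivative (g x - (K + 1))) (at x)" by (simp add: U_def)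
    then show ?thesis unfolding real_differentiable_def by blast
  qed
  then have "{x. \<not> u differentiable (at x)} \<subseteq> {x. \<not> (U has_real_derivative g x) (at x)}" by blast
  ultimately show ?thesis by (rule negligible_subset)
qed

section \<open>Nontangential limits of bounded analytic functions\<close>

text \<open>On the radius \<open>|z - \<zeta>| = 1 - |z|\<close>, so aperture 2 contains radial
  points arbitrarily close to \<open>\<zeta>\<close>. This makes limits within the region
  non-vacuous, hence unique.\<close>

lemma islimpt_stolz_region:
  assumes "cmod \<zeta> = 1"
  shows "\<zeta> islimpt stolz_region \<zeta> 2"
  unfolding islimpt_approachable
proof (intro allI impI)
  fix e :: real assume e: "0 < e"
  define d where "d = min (e / 2) (1 / 2)"
  have d: "0 < d" "d < e" "d < 1" using e by (auto simp: d_def)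
  have n: "cmod ((1 - of_real d) * \<zeta>) = 1 - d"
  proof -
    have "cmod (1 - of_real d) = \<bar>1 - d\<bar>" by (metis norm_of_real of_real_1 of_real_diff)
    then show ?thesis using assms d by (simp add: norm_mult)
  qed
  have "(1 - of_real d) * \<zeta> - \<zeta> = - of_real d * \<zeta>" by (simp add: algebra_simps)
  then have m: "cmod ((1 - of_real d) * \<zeta> - \<zeta>) = d" using assms d by (simp add: norm_mult)
  have "(1 - of_real d) * \<zeta> \<in> stolz_region \<zeta> 2" using n m d by (simp add: stolz_region_def)
  moreover have "(1 - of_real d) * \<zeta> \<noteq> \<zeta>" using m d by auto
  ultimately show "\<exists>w\<in>stolz_region \<zeta> 2. w \<noteq> \<zeta> \<and> dist w \<zeta> < e"
    using m d by (intro bexI[of _ "(1 - of_real d) * \<zeta>"]) (auto simp: dist_norm)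
qed

text \<open>Removing the first-order part of \<open>F\<close> at \<open>\<zeta>\<close> leaves
  \<open>G\<close>, which is \<open>o(|w - \<zeta>|)\<close> on the circle and has
  \<open>deriv G z = deriv F z - L\<close>. In the Cauchy integral for this derivative, the arc near
  \<open>\<zeta>\<close> is dominated by a small multiple of the Poisson kernel, whose integral does
  not depend on \<open>z\<close>, and the rest of the circle contributes a multiple of
  \<open>1 - |z|\<close>.\<close>

lemma has_nt_limit_deriv:
  fixes F :: "complex \<Rightarrow> complex"
  assumes cont: "continuous_on (cball 0 1) F" and hol: "F holomorphic_on ball 0 1"
    and \<zeta>: "cmod \<zeta> = 1"
    and D: "(F has_field_derivative L) (at \<zeta> within sphere 0 1)"
  shows "has_nt_limit (deriv F) \<zeta> L"
  unfolding has_nt_limit_def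
proof (intro allI impI)
  fix \<alpha> :: real assume \<alpha>: "1 < \<alpha>"
  define G where "G w = F w - F \<zeta> - L * (w - \<zeta>)" for w
  have contG: "continuous_on (cball 0 1) G" unfolding G_def by (intro continuous_intros cont)
  have holG: "G holomorphic_on ball 0 1" unfolding G_def by (intro holomorphic_intros hol)
  obtain M where M: "M > 0" "\<And>w. w \<in> cball 0 1 \<Longrightarrow> cmod (G w) \<le> M"
    using compact_imp_bounded[OF compact_continuous_image[OF contG compact_cball]]
    unfolding bounded_pos by auto
  \<comment> \<open>The pole reflected across the circle contributes nothing to the Cauchy integral, but
    subtracting it improves the kernel from order \<open>|w - z|\<^sup>-\<^sup>2\<close> to
    \<open>(1 - |z|) |w - z|\<^sup>-\<^sup>3\<close>; against \<open>|G w| \<le> \<epsilon> |w - \<zeta>|\<close> the order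
    \<open>|w - z|\<^sup>-\<^sup>2\<close> would only give a logarithmically divergent bound.\<close>
  define k where "k z w = 1 / (w - z)\<^sup>2 - 1 / (w - 1 / cnj z)\<^sup>2" for z w
  have kbound: "cmod (k z w) \<le> 4 * (1 - cmod z) / cmod (w - z) ^ 3"
    if z: "cmod z < 1" "z \<noteq> 0" and w: "cmod w = 1" for z w
  proof -
    let ?z' = "1 / cnj z"
    have r: "0 < cmod z" using z by simp
    have nz: "w - z \<noteq> 0" using z w by auto
    have d': "cmod (w - ?z') = cmod (w - z) / cmod z"
    proof -
      have "w - ?z' = - w * cnj (w - z) / cnj z"
      proof -
        have "w * cnj w = 1" using w by (simp add: complex_norm_square[symmetric])
        then show ?thesis using z by (simp add: field_simps)
      qed
      then show ?thesis using w by (simp add: norm_divide norm_mult del: complex_cnj_diff)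
    qed
    have nz': "w - ?z' \<noteq> 0" using d' nz r by auto
    have dz: "cmod (z - ?z') = (1 - (cmod z)\<^sup>2) / cmod z"
    proof -
      have "z - ?z' = - of_real (1 - (cmod z)\<^sup>2) / cnj z"
        using z complex_norm_square[of z] by (simp add: field_simps)
      moreover have "0 \<le> 1 - (cmod z)\<^sup>2" using z by (simp add: power_le_one)
      ultimately show ?thesis by (simp add: norm_divide del: of_real_diff)
    qed
    have "k z w = (z - ?z') * ((w - z) + (w - ?z')) / ((w - z)\<^sup>2 * (w - ?z')\<^sup>2)"
    proof -
      have gen: "1 / a\<^sup>2 - 1 / b\<^sup>2 = (b - a) * (a + b) / (a\<^sup>2 * b\<^sup>2)" if "a \<noteq> 0" "b \<noteq> 0" for a b :: complex
        using that by (simp add: field_simps power2_eq_square)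
      show ?thesis unfolding k_def gen[OF nz nz'] by simp
    qed
    then have "cmod (k z w) = cmod (z - ?z') * cmod ((w - z) + (w - ?z')) / ((cmod (w - z))\<^sup>2 * (cmod (w - ?z'))\<^sup>2)"
      by (simp only: norm_divide norm_mult norm_power)
    also have "\<dots> \<le> cmod (z - ?z') * (cmod (w - z) + cmod (w - ?z')) / ((cmod (w - z))\<^sup>2 * (cmod (w - ?z'))\<^sup>2)"
      by (intro divide_right_mono mult_left_mono norm_triangle_ineq) auto
    also have "\<dots> = (1 - cmod z) * (1 + cmod z)\<^sup>2 / cmod (w - z) ^ 3"
    proof -
      have "cmod (w - z) \<noteq> 0" using nz by simp
      then show ?thesis unfolding d' dz using r
        by (simp add: field_simps power2_eq_square power3_eq_cube)
    qed
    also have "\<dots> \<le> (1 - cmod z) * 4 / cmod (w - z) ^ 3"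
    proof (intro divide_right_mono mult_left_mono)
      have "(1 + cmod z)\<^sup>2 \<le> 2\<^sup>2" using z by (intro power_mono) auto
      then show "(1 + cmod z)\<^sup>2 \<le> 4" by simp
    qed (use z in auto)
    finally show ?thesis by (simp add: mult.commute)
  qed
  have repr: "((\<lambda>t. G (cis t) * k z (cis t) * cis t) has_integral (2 * of_real pi * (deriv F z - L))) {0..2 * pi}"
    if z: "cmod z < 1" "z \<noteq> 0" for z
  proof -
    have zb: "z \<in> ball 0 1" using z by simp
    have "((\<lambda>u. G u / (u - z) ^ Suc 1) has_contour_integral ((2 * pi * \<i>) / (fact 1) * (deriv ^^ 1) G z)) (circlepath 0 1)"
      by (rule Cauchy_has_contour_integral_higher_derivative_circlepath[OF contG holG zb])
    moreover have "(deriv ^^ 1) G z = deriv F z - L"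
    proof -
      have "(F has_field_derivative deriv F z) (at z)"
        using hol zb by (simp add: holomorphic_derivI)
      then have "(G has_field_derivative (deriv F z - L)) (at z)"
        unfolding G_def by (auto intro!: derivative_eq_intros)
      then show ?thesis by (simp add: DERIV_imp_deriv)
    qed
    ultimately have 1: "((\<lambda>u. G u / (u - z)\<^sup>2) has_contour_integral (2 * pi * \<i> * (deriv F z - L))) (circlepath 0 1)"
      by (simp add: numeral_2_eq_2)
    have nz: "u - 1 / cnj z \<noteq> 0" if "cmod u \<le> 1" for u
    proof
      assume "u - 1 / cnj z = 0"
      then have "cmod u = 1 / cmod z" by (simp add: norm_divide)
      then have "1 = cmod u * cmod z" using z by simp
      also have "\<dots> \<le> 1 * cmod z" using that by (intro mult_right_mono) auto
      finally show False using z by simp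
    qed
    have 2: "((\<lambda>u. G u / (u - 1 / cnj z)\<^sup>2) has_contour_integral 0) (circlepath 0 1)"
    proof (rule Cauchy_theorem_convex[where S="cball 0 1" and K="{}"])
      show "continuous_on (cball 0 1) (\<lambda>u. G u / (u - 1 / cnj z)\<^sup>2)"
        by (intro continuous_intros contG) (use nz in auto)
      fix u :: complex assume u: "u \<in> interior (cball 0 1) - {}"
      have "(\<lambda>u. G u / (u - 1 / cnj z)\<^sup>2) holomorphic_on ball 0 1"
        by (intro holomorphic_intros holG) (use nz in auto)
      then show "(\<lambda>u. G u / (u - 1 / cnj z)\<^sup>2) field_differentiable at u"
        using u by (auto simp: interior_cball intro: holomorphic_on_imp_differentiable_at)
    qed auto
    have "((\<lambda>u. G u / (u - z)\<^sup>2 - G u / (u - 1 / cnj z)\<^sup>2) has_contour_integral (2 * pi * \<i> * (deriv F z - L) - 0)) (circlepath 0 1)"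
      by (rule has_contour_integral_diff[OF 1 2])
    then have "((\<lambda>t. (G (cis t) / (cis t - z)\<^sup>2 - G (cis t) / (cis t - 1 / cnj z)\<^sup>2) * \<i> * cis t) has_integral
        (2 * pi * \<i> * (deriv F z - L))) {0..2 * pi}"
      by (simp add: circlepath_def has_contour_integral_part_circlepath_iff)
    then have "((\<lambda>t. - \<i> * ((G (cis t) / (cis t - z)\<^sup>2 - G (cis t) / (cis t - 1 / cnj z)\<^sup>2) * \<i> * cis t)) has_integral
        (- \<i> * (2 * pi * \<i> * (deriv F z - L)))) {0..2 * pi}"
      by (rule has_integral_mult_right)
    moreover have "- \<i> * (2 * pi * \<i> * (deriv F z - L)) = 2 * of_real pi * (deriv F z - L)"
      by (simp add: algebra_simps)
    moreover have "- \<i> * ((G (cis t) / (cis t - z)\<^sup>2 - G (cis t) / (cis t - 1 / cnj z)\<^sup>2) * \<i> * cis t) = G (cis t) * k z (cis t) * cis t" for t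
      by (simp add: k_def algebra_simps)
    ultimately show ?thesis by (simp only:)
  qed
  show "(deriv F \<longlongrightarrow> L) (at \<zeta> within stolz_region \<zeta> \<alpha>)"
  proof (rule tendstoI)
    fix e :: real assume e: "0 < e"
    \<comment> \<open>In the Stolz region
      \<open>|w - \<zeta>| \<le> (1 + \<alpha>) * |w - z|\<close>; together with the factor 4 in
      \<open>kbound\<close> this choice gives \<open>e / 2\<close> in front of the Poisson
      kernel.\<close>
    define \<epsilon> where "\<epsilon> = e / (8 * (1 + \<alpha>))"
    have eps: "\<epsilon> > 0" using e \<alpha> by (simp add: \<epsilon>_def)
    have "((\<lambda>w. (F w - F \<zeta>) / (w - \<zeta>)) \<longlongrightarrow> L) (at \<zeta> within sphere 0 1)"
      using D by (simp add: has_field_derivative_iff)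
    from tendstoD[OF this eps] obtain \<delta> where \<delta>: "\<delta> > 0"
        "\<forall>w\<in>sphere 0 1. w \<noteq> \<zeta> \<and> dist w \<zeta> < \<delta> \<longrightarrow> dist ((F w - F \<zeta>) / (w - \<zeta>)) L < \<epsilon>"
      unfolding eventually_at by blast
    have Gnear: "cmod (G w) \<le> \<epsilon> * cmod (w - \<zeta>)" if w: "cmod w = 1" "cmod (w - \<zeta>) < \<delta>" for w
    proof (cases "w = \<zeta>")
      case False
      then have "cmod ((F w - F \<zeta>) / (w - \<zeta>) - L) < \<epsilon>" using \<delta>(2) w by (simp add: dist_norm)
      moreover have "G w = ((F w - F \<zeta>) / (w - \<zeta>) - L) * (w - \<zeta>)" using False by (simp add: G_def field_simps)
      ultimately show ?thesis by (simp add: norm_mult mult_right_mono)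
    qed (simp add: G_def)
    \<comment> \<open>The first bound keeps \<open>z\<close> away from 0, so that the reflected
      point exists. The second gives \<open>|w - z| \<ge> \<delta> / 2\<close> whenever
      \<open>|w - \<zeta>| \<ge> \<delta>\<close>. The third makes the far contribution less than
      \<open>e / 2\<close>.\<close>
    define \<eta> where "\<eta> = min (1/2) (min (\<delta> / (4 * \<alpha>)) (e * \<delta> ^ 3 / (64 * M)))"
    have \<eta>: "\<eta> > 0" using e \<delta> M \<alpha> by (simp add: \<eta>_def)
    have main: "cmod (deriv F z - L) < e" if z: "z \<in> stolz_region \<zeta> \<alpha>" and d: "dist z \<zeta> < \<eta>" for z
    proof -
      let ?s = "1 - cmod z"
      have z1: "cmod z < 1" and zs: "cmod (z - \<zeta>) < \<alpha> * ?s" using z by (auto simp: stolz_region_def)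
      have s: "0 < ?s" using z1 by simp
      have s\<eta>: "?s < \<eta>"
      proof -
        have "1 \<le> cmod z + cmod (z - \<zeta>)" using \<zeta> norm_triangle_sub[of \<zeta> z] by (simp add: norm_minus_commute)
        then show ?thesis using d by (simp add: dist_norm)
      qed
      then have z0: "z \<noteq> 0" unfolding \<eta>_def by auto
      \<comment> \<open>The first summand majorizes the integrand on the arc within
        \<open>\<delta>\<close> of \<open>\<zeta>\<close>, the second majorizes it on the rest.
        Adding them avoids splitting the integral.\<close>
      define B where "B t = e / 2 * ((1 - (cmod z)\<^sup>2) / (cmod (cis t - z))\<^sup>2) + 32 * M * ?s / \<delta> ^ 3" for t
      have Bint: "(B has_integral (e / 2 * (2 * pi) + (2 * pi) * (32 * M * ?s / \<delta> ^ 3))) {0..2 * pi}"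
      proof -
        have "((\<lambda>t. 32 * M * ?s / \<delta> ^ 3) has_integral (2 * pi) * (32 * M * ?s / \<delta> ^ 3)) {0..2 * pi}"
          using has_integral_const_real[of "32 * M * ?s / \<delta> ^ 3" 0 "2 * pi"] by simp
        then show ?thesis unfolding B_def
          by (intro has_integral_add has_integral_mult_right poisson_kernel_has_integral z1)
      qed
      have bnd: "cmod (G (cis t) * k z (cis t) * cis t) \<le> B t" for t
      proof -
        let ?w = "cis t"
        have wz: "?s \<le> cmod (?w - z)" using norm_triangle_ineq2[of ?w z] by simp
        then have wz0: "0 < cmod (?w - z)" using s by linarith
        have "cmod (?w - \<zeta>) \<le> cmod (?w - z) + cmod (z - \<zeta>)" using norm_triangle_ineq[of "?w - z" "z - \<zeta>"] by simp
        also have "\<dots> \<le> cmod (?w - z) + \<alpha> * cmod (?w - z)"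
        proof -
          have "\<alpha> * ?s \<le> \<alpha> * cmod (?w - z)" by (rule mult_left_mono[OF wz]) (use \<alpha> in simp)
          then show ?thesis using zs by linarith
        qed
        finally have w\<zeta>: "cmod (?w - \<zeta>) \<le> (1 + \<alpha>) * cmod (?w - z)" by (simp add: algebra_simps)
        have P0: "0 \<le> e / 2 * ((1 - (cmod z)\<^sup>2) / (cmod (?w - z))\<^sup>2)"
          using z1 e by (intro mult_nonneg_nonneg divide_nonneg_nonneg) (auto simp: power_le_one)
        have Y0: "0 \<le> 32 * M * ?s / \<delta> ^ 3" using M s \<delta>(1) by simp
        have *: "cmod (G ?w * k z ?w * ?w) \<le> cmod (G ?w) * (4 * ?s / cmod (?w - z) ^ 3)"
          unfolding norm_mult norm_cis mult_1_right
          by (rule mult_left_mono[OF kbound[OF z1 z0]]) auto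
        show ?thesis
        proof (cases "cmod (?w - \<zeta>) < \<delta>")
          case True
          have "cmod (G ?w) \<le> \<epsilon> * ((1 + \<alpha>) * cmod (?w - z))"
          proof -
            have "\<epsilon> * cmod (?w - \<zeta>) \<le> \<epsilon> * ((1 + \<alpha>) * cmod (?w - z))"
              by (rule mult_left_mono[OF w\<zeta>]) (use eps in simp)
            then show ?thesis using Gnear[of ?w] True by simp
          qed
          also have "\<dots> = e / 8 * cmod (?w - z)" using \<alpha> by (simp add: \<epsilon>_def field_simps)
          finally have "cmod (G ?w) * (4 * ?s / cmod (?w - z) ^ 3) \<le> e / 8 * cmod (?w - z) * (4 * ?s / cmod (?w - z) ^ 3)"
            using s by (intro mult_right_mono) auto
          also have "\<dots> = e / 2 * (?s / (cmod (?w - z))\<^sup>2)"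
            using wz0 by (simp add: field_simps power2_eq_square power3_eq_cube)
          also have "\<dots> \<le> e / 2 * ((1 - (cmod z)\<^sup>2) / (cmod (?w - z))\<^sup>2)"
          proof (intro mult_left_mono divide_right_mono)
            show "?s \<le> 1 - (cmod z)\<^sup>2" using z1 by (simp add: power2_eq_square mult_left_le)
          qed (use e in auto)
          finally show ?thesis using * Y0 unfolding B_def by linarith
        next
          case False
          have "\<alpha> * ?s \<le> \<delta> / 4"
          proof -
            have "?s < \<delta> / (4 * \<alpha>)" using s\<eta> by (simp add: \<eta>_def)
            then show ?thesis using \<alpha> by (simp add: field_simps)
          qed
          then have "cmod (z - \<zeta>) \<le> \<delta> / 2" using zs \<delta>(1) by simp
          then have "\<delta> / 2 \<le> cmod (?w - z)"
            using False norm_triangle_ineq[of "?w - z" "z - \<zeta>"] by simp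
          then have "(\<delta> / 2) ^ 3 \<le> cmod (?w - z) ^ 3" using \<delta>(1) by (intro power_mono) auto
          then have "4 * ?s / cmod (?w - z) ^ 3 \<le> 4 * ?s / (\<delta> / 2) ^ 3"
            using s \<delta>(1) wz0 by (intro divide_left_mono mult_pos_pos zero_less_power) auto
          then have "cmod (G ?w) * (4 * ?s / cmod (?w - z) ^ 3) \<le> M * (4 * ?s / (\<delta> / 2) ^ 3)"
            using M s by (intro mult_mono) auto
          also have "\<dots> = 32 * M * ?s / \<delta> ^ 3" by (simp add: power_divide)
          finally show ?thesis using * P0 unfolding B_def by linarith
        qed
      qed
      have "2 * pi * cmod (deriv F z - L) = cmod (2 * of_real pi * (deriv F z - L))"
        by (simp add: norm_mult)
      also have "\<dots> \<le> e / 2 * (2 * pi) + (2 * pi) * (32 * M * ?s / \<delta> ^ 3)"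
        using Henstock_Kurzweil_Integration.integral_norm_bound_integral[of "\<lambda>t. G (cis t) * k z (cis t) * cis t" "{0..2*pi}" B] bnd
          repr[OF z1 z0] Bint by (simp add: has_integral_iff)
      finally have "cmod (deriv F z - L) \<le> e / 2 + 32 * M * ?s / \<delta> ^ 3"
      proof -
        assume "2 * pi * cmod (deriv F z - L) \<le> e / 2 * (2 * pi) + (2 * pi) * (32 * M * ?s / \<delta> ^ 3)"
        also have "\<dots> = 2 * pi * (e / 2 + 32 * M * ?s / \<delta> ^ 3)" by (simp add: distrib_left mult.commute)
        finally show ?thesis by (rule mult_left_le_imp_le) simp
      qed
      also have "\<dots> < e"
      proof -
        have "?s < e * \<delta> ^ 3 / (64 * M)" using s\<eta> by (simp add: \<eta>_def)
        then have "64 * M * ?s < e * \<delta> ^ 3" using M by (simp add: pos_less_divide_eq mult.commute)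
        then show ?thesis using \<delta>(1) by (simp add: field_simps)
      qed
      finally show ?thesis .
    qed
    then show "\<forall>\<^sub>F z in at \<zeta> within stolz_region \<zeta> \<alpha>. dist (deriv F z) L < e"
      unfolding eventually_at by (intro exI[of _ \<eta>]) (auto simp: \<eta> dist_norm)
  qed
qed

lemma has_vector_derivative_complex_quotient:
  fixes f :: "real \<Rightarrow> complex"
  assumes "(f has_vector_derivative d) (at s)"
  shows "((\<lambda>t. (f t - f s) / of_real (t - s)) \<longlongrightarrow> d) (at s)"
  using assms unfolding has_vector_derivative_complex_iff has_field_derivative_iff tendsto_complex_iff
  by simp

lemma has_field_derivative_circle:
  assumes d: "((\<lambda>t. F (cis t)) has_vector_derivative d) (at s)"
  shows "(F has_field_derivative d / (\<i> * cis s)) (at (cis s) within sphere 0 1)"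
proof -
  let ?\<zeta> = "cis s"
  define Q where "Q t = (F (cis t) - F (cis s)) / (cis t - cis s)" for t
  \<comment> \<open>Dividing by \<open>?\<zeta>\<close> moves the base point to 1, away from the
    branch cut of \<open>Ln\<close>. So \<open>\<theta>\<close> is a right inverse of
    \<open>cis\<close> on the circle that is continuous at \<open>cis s\<close>, whatever
    \<open>s\<close> is.\<close>
  define \<theta> where "\<theta> w = s + Im (Ln (w / ?\<zeta>))" for w
  have "((\<lambda>t. ((F (cis t) - F (cis s)) / of_real (t - s)) / ((cis t - cis s) / of_real (t - s))) \<longlongrightarrow> d / (\<i> * cis s)) (at s)"
  proof (rule tendsto_divide)
    show "((\<lambda>t. (F (cis t) - F (cis s)) / of_real (t - s)) \<longlongrightarrow> d) (at s)"
      by (rule has_vector_derivative_complex_quotient[OF d])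
    have "(cis has_vector_derivative (\<i> * cis s)) (at s)"
      unfolding has_vector_derivative_complex_iff by (auto intro!: derivative_eq_intros)
    then show "((\<lambda>t. (cis t - cis s) / of_real (t - s)) \<longlongrightarrow> \<i> * cis s) (at s)"
      by (rule has_vector_derivative_complex_quotient)
  qed simp
  then have Q: "(Q \<longlongrightarrow> d / (\<i> * cis s)) (at s)"
  proof (rule Lim_transform_eventually)
    show "\<forall>\<^sub>F t in at s. (F (cis t) - F (cis s)) / of_real (t - s) / ((cis t - cis s) / of_real (t - s)) = Q t"
      unfolding eventually_at_filter Q_def by (auto simp flip: of_real_diff)
  qed
  have cis_\<theta>: "cis (\<theta> w) = w" if "cmod w = 1" for w
  proof -
    have w0: "w / ?\<zeta> \<noteq> 0" using that by auto
    have "Re (Ln (w / ?\<zeta>)) = 0" using w0 that by (simp add: norm_divide)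
    then have "Ln (w / ?\<zeta>) = \<i> * of_real (Im (Ln (w / ?\<zeta>)))" by (simp add: complex_eq_iff)
    then have "w / ?\<zeta> = cis (Im (Ln (w / ?\<zeta>)))" by (metis cis_conv_exp exp_Ln w0)
    then show ?thesis by (simp add: \<theta>_def flip: cis_mult)
  qed
  have "isCont \<theta> ?\<zeta>" unfolding \<theta>_def
    by (intro continuous_intros isCont_o2[OF _ isCont_Im]) auto
  then have "(\<theta> \<longlongrightarrow> \<theta> ?\<zeta>) (at ?\<zeta> within sphere 0 1)"
    unfolding isCont_def by (rule tendsto_within_subset) simp
  moreover have "\<theta> ?\<zeta> = s" by (simp add: \<theta>_def)
  moreover have "\<theta> w \<noteq> s" if "cmod w = 1" "w \<noteq> ?\<zeta>" for w
    using cis_\<theta>[of w] that by auto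
  then have "\<forall>\<^sub>F w in at ?\<zeta> within sphere 0 1. \<theta> w \<noteq> s"
    unfolding eventually_at_filter by (intro always_eventually) auto
  ultimately have "filterlim \<theta> (at s) (at ?\<zeta> within sphere 0 1)"
    unfolding filterlim_at by simp
  then have "((\<lambda>w. Q (\<theta> w)) \<longlongrightarrow> d / (\<i> * cis s)) (at ?\<zeta> within sphere 0 1)"
    by (rule filterlim_compose[OF Q])
  then have "((\<lambda>w. (F w - F ?\<zeta>) / (w - ?\<zeta>)) \<longlongrightarrow> d / (\<i> * cis s)) (at ?\<zeta> within sphere 0 1)"
    by (rule Lim_transform_eventually)
       (simp add: eventually_at_filter Q_def cis_\<theta>)
  then show ?thesis by (simp add: has_field_derivative_iff)
qed

theorem Fatou_nontangential:
  assumes b: "b \<in> Hinf_unit_ball"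
  shows "AE \<zeta> in circle_measure. nt_convergent b \<zeta>"
proof -
  have hol: "b holomorphic_on ball 0 1" and bd: "\<And>z. z \<in> ball 0 1 \<Longrightarrow> cmod (b z) \<le> 1"
    using b by (auto simp: Hinf_unit_ball_def)
  obtain F0 where F0: "\<And>x. x \<in> ball 0 1 \<Longrightarrow> (F0 has_field_derivative b x) (at x within ball 0 1)"
    using holomorphic_convex_primitive'[of "ball 0 1" b] hol by auto
  have "1-lipschitz_on (ball 0 1) F0"
  proof (rule lipschitz_onI)
    fix x y :: complex assume "x \<in> ball 0 1" "y \<in> ball 0 1"
    then show "dist (F0 x) (F0 y) \<le> 1 * dist x y"
      unfolding dist_norm by (intro field_differentiable_bound[OF convex_ball F0 bd])
  qed simp
  \<comment> \<open>The Lipschitz extension to the closed disc serves twice: it is continuous up to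
    the contour of the Cauchy integral, and it is Lipschitz in the angle.\<close>
  then obtain F where F: "1-lipschitz_on (cball 0 1) F" "\<And>x. x \<in> ball 0 1 \<Longrightarrow> F x = F0 x"
    using lipschitz_extend_closure[of 1 "ball 0 1" F0] by auto
  have dF: "(F has_field_derivative b z) (at z)" if "z \<in> ball 0 1" for z
  proof (rule has_field_derivative_transform_within_open[of F0 _ _ "ball 0 1"])
    show "(F0 has_field_derivative b z) (at z)"
      using F0[OF that] that by (simp only: at_within_open[OF that open_ball])
  qed (use F that in auto)
  have contF: "continuous_on (cball 0 1) F" using F(1) by (rule lipschitz_on_continuous_on)
  have holF: "F holomorphic_on ball 0 1" unfolding holomorphic_on_open[OF open_ball] using dF by blast
  have lipc: "cmod (F (cis s) - F (cis t)) \<le> \<bar>s - t\<bar>" for s t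
  proof -
    have "cmod (cis s - cis t) \<le> \<bar>s - t\<bar>"
    proof -
      have "cis s - cis t = cis t * (exp (\<i> * of_real (s - t)) - 1)"
        by (simp add: cis_mult cis_conv_exp[symmetric] right_diff_distrib del: of_real_diff)
      then have "cmod (cis s - cis t) = 2 * \<bar>sin ((s - t) / 2)\<bar>"
        by (simp add: norm_mult dist_exp_i_1 del: of_real_diff)
      also have "\<dots> \<le> 2 * \<bar>(s - t) / 2\<bar>" by (intro mult_left_mono abs_sin_x_le_abs_x) simp
      finally show ?thesis by simp
    qed
    moreover have "cmod (F (cis s) - F (cis t)) \<le> cmod (cis s - cis t)"
      using lipschitz_onD[OF F(1), of "cis s" "cis t"] by (simp add: dist_norm)
    ultimately show ?thesis by simp
  qed
  have Re: "1-lipschitz_on UNIV (\<lambda>t. Re (F (cis t)))" and Im: "1-lipschitz_on UNIV (\<lambda>t. Im (F (cis t)))"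
    using lipc abs_Re_le_cmod abs_Im_le_cmod
    by (auto intro!: lipschitz_onI simp: dist_real_def) (metis minus_complex.sel order_trans)+
  have "negligible ({t. \<not> (\<lambda>t. Re (F (cis t))) differentiable (at t)} \<union> {t. \<not> (\<lambda>t. Im (F (cis t))) differentiable (at t)})"
    by (intro negligible_Un negligible_not_differentiable_Lipschitz[OF Re] negligible_not_differentiable_Lipschitz[OF Im])
  from AE_circle_measure_cis[OF this] show ?thesis
  proof (rule AE_mp, intro AE_I2 impI)
    fix \<zeta> assume "\<exists>t. t \<notin> {t. \<not> (\<lambda>t. Re (F (cis t))) differentiable (at t)} \<union> {t. \<not> (\<lambda>t. Im (F (cis t))) differentiable (at t)} \<and> \<zeta> = cis t"
    then obtain t u v where t: "\<zeta> = cis t" "((\<lambda>t. Re (F (cis t))) has_real_derivative u) (at t)"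
        "((\<lambda>t. Im (F (cis t))) has_real_derivative v) (at t)"
      by (auto simp: real_differentiable_def)
    then have "((\<lambda>t. F (cis t)) has_vector_derivative Complex u v) (at t)"
      by (simp add: has_vector_derivative_complex_iff)
    from has_field_derivative_circle[OF this]
    have "has_nt_limit (deriv F) \<zeta> (Complex u v / (\<i> * cis t))"
      using t by (intro has_nt_limit_deriv[OF contF holF]) auto
    then have "has_nt_limit b \<zeta> (Complex u v / (\<i> * cis t))"
      unfolding has_nt_limit_def
    proof (elim all_forward imp_forward)
      fix \<alpha> assume "(deriv F \<longlongrightarrow> Complex u v / (\<i> * cis t)) (at \<zeta> within stolz_region \<zeta> \<alpha>)"
      then show "(b \<longlongrightarrow> Complex u v / (\<i> * cis t)) (at \<zeta> within stolz_region \<zeta> \<alpha>)"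
      proof (rule Lim_transform_eventually)
        show "\<forall>\<^sub>F z in at \<zeta> within stolz_region \<zeta> \<alpha>. deriv F z = b z"
          unfolding eventually_at_filter
          by (intro always_eventually) (auto simp: stolz_region_def DERIV_imp_deriv[OF dF])
      qed
    qed
    then show "nt_convergent b \<zeta>" by (auto simp: nt_convergent_def)
  qed
qed

section \<open>The absolutely continuous part of a measure\<close>

text \<open>The union \<open>S\<close> of a sequence of \<open>M\<close>-null sets whose
  \<open>N\<close>-mass tends to the supremum attains that supremum, so every \<open>M\<close>-null
  set has zero \<open>N\<close>-mass outside \<open>S\<close>. This yields a decomposition; as
  \<open>ac_part\<close> is a definite description, uniqueness has to be shown as well.\<close>

lemma ac_part_eq_density:
  assumes N: "finite_measure N" and sets: "sets N = sets M"
  obtains S where "S \<in> null_sets M" "ac_part M N = density N (indicator (space M - S))"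
    "absolutely_continuous M (ac_part M N)"
proof -
  interpret finite_measure N by fact
  note [measurable_cong] = sets
  have sp: "space N = space M" using sets by (rule sets_eq_imp_space_eq)
  have "{} \<in> null_sets M" by simp
  then have ne: "null_sets M \<noteq> {}" by blast
  then obtain f :: "nat \<Rightarrow> ennreal" where f: "range f \<subseteq> emeasure N ` null_sets M"
      "(SUP A\<in>null_sets M. emeasure N A) = Sup (range f)"
    using ennreal_SUP_countable_SUP[of "null_sets M" "emeasure N"] by blast
  then have "\<forall>n. \<exists>A\<in>null_sets M. f n = emeasure N A" by blast
  then obtain T where T: "\<And>n. T n \<in> null_sets M" "\<And>n. f n = emeasure N (T n)" by metis
  define S where "S = (\<Union>n. T n)"
  have S: "S \<in> null_sets M" unfolding S_def using T(1) by auto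
  have S_max: "emeasure N A \<le> emeasure N S" if "A \<in> null_sets M" for A
  proof -
    have "emeasure N A \<le> Sup (range f)" using that unfolding f(2)[symmetric] by (rule SUP_upper)
    also have "\<dots> \<le> emeasure N S"
      using S sets by (auto intro!: SUP_least emeasure_mono simp: T(2)) (auto simp: S_def)
    finally show ?thesis .
  qed
  have S_outside: "emeasure N (A - S) = 0" if A: "A \<in> null_sets M" for A
  proof -
    have "emeasure N S + emeasure N (A - S) = emeasure N (S \<union> (A - S))"
      using S A sets by (intro plus_emeasure) auto
    also have "\<dots> \<le> emeasure N S + 0"
      using S_max[of "S \<union> (A - S)"] S A by (auto intro: null_sets.Un null_set_Diff simp: Un_Diff_cancel)
    finally show ?thesis
      using emeasure_finite[of S] by (subst (asm) ennreal_add_left_cancel_le) auto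
  qed
  let ?Na = "density N (indicator (space M - S))" and ?Ns = "density N (indicator S)"
  have Sm [measurable]: "S \<in> sets M" using S by auto
  have Na: "emeasure ?Na A = emeasure N (A - S)" if [measurable]: "A \<in> sets M" for A
  proof -
    have "(space M - S) \<inter> A = A - S" using sets.sets_into_space[OF that] by auto
    then show ?thesis using that by (simp add: emeasure_density sets flip: indicator_inter_arith)
  qed
  have Ns: "emeasure ?Ns A = emeasure N (S \<inter> A)" if [measurable]: "A \<in> sets M" for A
    using that by (simp add: emeasure_density sets flip: indicator_inter_arith)
  have ac: "absolutely_continuous M ?Na"
    unfolding absolutely_continuous_def
  proof
    fix A assume A: "A \<in> null_sets M"
    then show "A \<in> null_sets ?Na" using S_outside[OF A] by (auto simp: null_sets_def[of ?Na] Na sets)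
  qed
  have dec: "lebesgue_decomposition M N ?Na ?Ns"
    unfolding lebesgue_decomposition_def
  proof (intro conjI ballI bexI[of _ S] ac S)
    show "emeasure ?Ns (space M - S) = 0" by (subst Ns) auto
    fix A assume [measurable]: "A \<in> sets M"
    have "emeasure N (A - S) + emeasure N (S \<inter> A) = emeasure N ((A - S) \<union> (S \<inter> A))"
      by (rule plus_emeasure) (auto simp: sets)
    also have "(A - S) \<union> (S \<inter> A) = A" by auto
    finally show "emeasure N A = emeasure ?Na A + emeasure ?Ns A" by (simp add: Na Ns)
  qed (auto simp: sets)
  have "ac_part M N = ?Na"
    unfolding ac_part_def
  proof (rule the_equality)
    show "\<exists>Ns. lebesgue_decomposition M N ?Na Ns" using dec by blast
    fix Na' assume "\<exists>Ns'. lebesgue_decomposition M N Na' Ns'"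
    then obtain Ns' S' where D: "sets Na' = sets M" "sets Ns' = sets M" "absolutely_continuous M Na'"
        "S' \<in> null_sets M" "emeasure Ns' (space M - S') = 0"
        "\<And>A. A \<in> sets M \<Longrightarrow> emeasure N A = emeasure Na' A + emeasure Ns' A"
      unfolding lebesgue_decomposition_def by auto
    show "Na' = ?Na"
    proof (rule measure_eqI)
      fix A assume "A \<in> sets Na'"
      then have A: "A \<in> sets M" using D by simp
      have S'm: "S' \<in> sets M" using D(4) by auto
      \<comment> \<open>Outside both exceptional sets the two candidates agree with
        \<open>N\<close>. Restoring the removed points changes neither: \<open>Na'\<close> ignores
        \<open>M\<close>-null sets, and \<open>N\<close> gives \<open>S' - S\<close> no mass by
        maximality of \<open>S\<close>.\<close>
      let ?B = "A - (S \<union> S')"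
      have B: "?B \<in> sets M" using A S'm by auto
      have "emeasure Ns' ?B \<le> emeasure Ns' (space M - S')"
        using sets.sets_into_space[OF A] S'm D(2) by (intro emeasure_mono) auto
      then have 1: "emeasure N ?B = emeasure Na' ?B" using D(6)[OF B] D(5) by simp
      have "S \<union> S' \<in> null_sets Na'" using D(3) S D(4) by (auto simp: absolutely_continuous_def)
      then have 2: "emeasure Na' ?B = emeasure Na' A"
        using A D(1) by (intro emeasure_Diff_null_set) auto
      have "emeasure N (A \<inter> (S' - S)) \<le> emeasure N (S' - S)"
        using A S'm sets by (intro emeasure_mono) auto
      then have "emeasure N (A \<inter> (S' - S)) = 0" using S_outside[OF D(4)] by simp
      then have "A \<inter> (S' - S) \<in> null_sets N" using A S'm sets by auto
      then have "emeasure N ((A - S) - A \<inter> (S' - S)) = emeasure N (A - S)"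
        using A sets by (intro emeasure_Diff_null_set) auto
      moreover have "(A - S) - A \<inter> (S' - S) = ?B" by auto
      ultimately show "emeasure Na' A = emeasure ?Na A" using 1 2 Na[OF A] by simp
    qed (simp add: D(1) sets)
  qed
  then show ?thesis using that[OF S] ac by simp
qed

text \<open>Zero density makes the absolutely continuous part the zero measure. Since that part is
  the restriction of \<open>\<mu>\<close> to the circle minus a null set \<open>S\<close>, all mass
  of \<open>\<mu>\<close> on the circle sits on \<open>S\<close>.\<close>

lemma circle_density_zero_imp_singular:
  assumes \<mu>: "\<mu> \<in> disc_measures" and h: "AE \<zeta> in circle_measure. circle_density \<mu> \<zeta> = 0"
  obtains S where "S \<in> null_sets circle_measure" "emeasure \<mu> (unit_circle - S) = 0"
proof -
  interpret \<mu>: finite_measure \<mu> using \<mu> by (simp add: disc_measures_def)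
  have sets\<mu>: "sets \<mu> = sets (restrict_space borel (cball 0 1))" using \<mu> by (simp add: disc_measures_def)
  have sp\<mu>: "space \<mu> = cball 0 1" using sets_eq_imp_space_eq[OF sets\<mu>] by (simp add: space_restrict_space)
  have T: "unit_circle \<in> sets \<mu>" unfolding sets\<mu> by (auto simp: sets_restrict_space_iff)
  let ?\<nu> = "restrict_space \<mu> unit_circle"
  have sets\<nu>: "sets ?\<nu> = sets circle_measure"
  proof -
    have "sets ?\<nu> = sets (restrict_space (restrict_space borel (cball 0 1)) unit_circle)"
      by (rule sets_restrict_space_cong[OF sets\<mu>])
    also have "\<dots> = sets (restrict_space borel (cball 0 1 \<inter> unit_circle))"
      by (subst sets_restrict_restrict_space) simp
    also have "cball 0 1 \<inter> unit_circle = (unit_circle :: complex set)" by auto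
    finally show ?thesis by simp
  qed
  have "finite_measure ?\<nu>" by (rule finite_measure_restrict_space) (use T \<mu>.finite_measure_axioms in simp_all)
  from ac_part_eq_density[OF this sets\<nu>] obtain S where S: "S \<in> null_sets circle_measure"
      "ac_part circle_measure ?\<nu> = density ?\<nu> (indicator (space circle_measure - S))"
      "absolutely_continuous circle_measure (ac_part circle_measure ?\<nu>)" .
  have Sm: "unit_circle - S \<in> sets ?\<nu>" using S(1) sets\<nu> sets.Diff[OF sets.top] by (metis null_setsD2 space_circle_measure)
  have "density circle_measure (circle_density \<mu>) = ac_part circle_measure ?\<nu>"
    unfolding circle_density_def
    by (rule circle_measure.density_RN_deriv[OF S(3)]) (simp add: S(2) sets\<nu>)
  moreover have "density circle_measure (circle_density \<mu>) = density circle_measure (\<lambda>_. 0)"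
    by (rule density_cong) (use h in \<open>auto simp: circle_density_def\<close>)
  ultimately have "density circle_measure (\<lambda>_. 0) = density ?\<nu> (indicator (unit_circle - S))"
    using S(2) by simp
  then have "emeasure (density circle_measure (\<lambda>_. 0)) (unit_circle - S) = emeasure (density ?\<nu> (indicator (unit_circle - S))) (unit_circle - S)"
    by simp
  moreover have "emeasure (density circle_measure (\<lambda>_. 0)) (unit_circle - S) = 0"
    using Sm unfolding sets\<nu> by (subst emeasure_density) auto
  moreover have "emeasure (density ?\<nu> (indicator (unit_circle - S))) (unit_circle - S) = emeasure ?\<nu> (unit_circle - S)"
    using Sm by (subst emeasure_density) (auto simp flip: indicator_inter_arith)
  ultimately have "emeasure ?\<nu> (unit_circle - S) = 0" by simp
  then have "emeasure \<mu> (unit_circle - S) = 0"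
  proof (subst (asm) emeasure_restrict_space)
    have "unit_circle \<inter> cball 0 1 = (unit_circle :: complex set)" by auto
    then show "unit_circle \<inter> space \<mu> \<in> sets \<mu>" using T sp\<mu> by simp
  qed auto
  then show ?thesis using that S(1) by blast
qed

section \<open>Reverse Carleson measures and level sets\<close>

lemma has_nt_limit_unique:
  assumes "cmod \<zeta> = 1" "has_nt_limit f \<zeta> L" "has_nt_limit f \<zeta> L'"
  shows "L = L'"
proof (rule tendsto_unique)
  show "(f \<longlongrightarrow> L) (at \<zeta> within stolz_region \<zeta> 2)" "(f \<longlongrightarrow> L') (at \<zeta> within stolz_region \<zeta> 2)"
    using assms by (auto simp: has_nt_limit_def)
  show "at \<zeta> within stolz_region \<zeta> 2 \<noteq> bot"
    using islimpt_stolz_region[OF assms(1)] by (simp add: trivial_limit_within)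
qed

lemma nt_ext_circle:
  assumes "cmod \<zeta> = 1" "has_nt_limit f \<zeta> L"
  shows "nt_ext f \<zeta> = L"
proof -
  have "(THE L. has_nt_limit f \<zeta> L) = L"
    using assms has_nt_limit_unique by blast
  then show ?thesis using assms by (auto simp: nt_ext_def nt_convergent_def)
qed

lemma nt_ext_unit_disc: "z \<in> unit_disc \<Longrightarrow> nt_ext f z = f z"
  by (simp add: nt_ext_def)

lemma nt_convergent_nt_ext:
  assumes "cmod \<zeta> = 1" "nt_convergent f \<zeta>"
  shows "has_nt_limit f \<zeta> (nt_ext f \<zeta>)"
  using assms nt_ext_circle by (metis nt_convergent_def)

lemma has_nt_limit_radial:
  assumes \<zeta>: "cmod \<zeta> = 1" and L: "has_nt_limit f \<zeta> L"
  shows "((\<lambda>r. f (of_real r * \<zeta>)) \<longlongrightarrow> L) (at_left 1)"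
proof -
  have f: "(f \<longlongrightarrow> L) (at \<zeta> within stolz_region \<zeta> 2)" using L by (simp add: has_nt_limit_def)
  have lim: "((\<lambda>r. of_real r * \<zeta>) \<longlongrightarrow> \<zeta>) (at_left (1::real))"
  proof -
    have "((\<lambda>r. of_real r * \<zeta>) \<longlongrightarrow> of_real 1 * \<zeta>) (at_left (1::real))"
      by (intro tendsto_intros)
    then show ?thesis by simp
  qed
  have inside: "of_real r * \<zeta> \<in> stolz_region \<zeta> 2 \<and> of_real r * \<zeta> \<noteq> \<zeta>" if r: "0 < r" "r < 1" for r :: real
  proof -
    have "of_real r * \<zeta> - \<zeta> = - of_real (1 - r) * \<zeta>" by (simp add: algebra_simps)
    then have "cmod (of_real r * \<zeta> - \<zeta>) = \<bar>1 - r\<bar>"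
      using \<zeta> by (simp only: norm_mult norm_minus_cancel norm_of_real mult_1_right)
    then have m: "cmod (of_real r * \<zeta> - \<zeta>) = 1 - r" using r by simp
    have "cmod (of_real r * \<zeta>) = r" using r \<zeta> by (simp add: norm_mult)
    then show ?thesis using m r by (auto simp: stolz_region_def)
  qed
  have "\<forall>\<^sub>F r in at_left (1::real). 0 < r \<and> r < 1"
    unfolding eventually_at_left_field by (intro exI[of _ 0]) auto
  then have "\<forall>\<^sub>F r in at_left (1::real). of_real r * \<zeta> \<in> stolz_region \<zeta> 2 \<and> of_real r * \<zeta> \<noteq> \<zeta>"
    by (rule eventually_mono) (use inside in blast)
  then have "filterlim (\<lambda>r. of_real r * \<zeta>) (at \<zeta> within stolz_region \<zeta> 2) (at_left (1::real))"
    using lim unfolding filterlim_at by simp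
  with f show ?thesis by (rule filterlim_compose)
qed

lemma has_nt_limit_le:
  assumes \<zeta>: "cmod \<zeta> = 1" and L: "has_nt_limit f \<zeta> L"
    and r0: "r0 < 1" and le: "\<And>r. r0 \<le> r \<Longrightarrow> r < 1 \<Longrightarrow> cmod (f (of_real r * \<zeta>) - a) \<le> d"
  shows "cmod (L - a) \<le> d"
proof (rule tendsto_upperbound)
  show "((\<lambda>r. cmod (f (of_real r * \<zeta>) - a)) \<longlongrightarrow> cmod (L - a)) (at_left 1)"
    by (intro tendsto_intros has_nt_limit_radial \<zeta> L)
  show "\<forall>\<^sub>F r in at_left 1. cmod (f (of_real r * \<zeta>) - a) \<le> d"
    unfolding eventually_at_left_field using r0 le by (intro exI[of _ r0]) auto
qed simp

lemma has_nt_limit_dBR_kernel: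
  assumes \<zeta>: "cmod \<zeta> = 1" and w: "cmod w < 1" and L: "has_nt_limit b \<zeta> L"
  shows "has_nt_limit (dBR_kernel b w) \<zeta> ((1 - cnj (b w) * L) / (1 - cnj w * \<zeta>))"
  unfolding has_nt_limit_def
proof (intro allI impI)
  fix \<alpha> :: real assume "1 < \<alpha>"
  then have "(b \<longlongrightarrow> L) (at \<zeta> within stolz_region \<zeta> \<alpha>)" using L by (simp add: has_nt_limit_def)
  moreover have "1 - cnj w * \<zeta> \<noteq> 0"
  proof
    assume "1 - cnj w * \<zeta> = 0"
    then have "cmod (cnj w * \<zeta>) = 1" by simp
    then show False using \<zeta> w by (simp add: norm_mult)
  qed
  ultimately have "((\<lambda>z. (1 - cnj (b w) * b z) / (1 - cnj w * z)) \<longlongrightarrow> (1 - cnj (b w) * L) / (1 - cnj w * \<zeta>))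
      (at \<zeta> within stolz_region \<zeta> \<alpha>)"
    by (intro tendsto_intros)
  then show "(dBR_kernel b w \<longlongrightarrow> (1 - cnj (b w) * L) / (1 - cnj w * \<zeta>)) (at \<zeta> within stolz_region \<zeta> \<alpha>)"
  proof (rule Lim_transform_eventually)
    show "\<forall>\<^sub>F z in at \<zeta> within stolz_region \<zeta> \<alpha>. (1 - cnj (b w) * b z) / (1 - cnj w * z) = dBR_kernel b w z"
      unfolding eventually_at_filter
      by (intro always_eventually) (auto simp: stolz_region_def dBR_kernel_def)
  qed
qed

section \<open>The reverse Carleson inequality on kernel functions\<close>

text \<open>By the reproducing property the squared norm of a kernel function is its value at
  \<open>w\<close>, the quotient on the left. It has a nontangential limit wherever \<open>b\<close>
  does, so admissibility of \<open>b\<close> makes it a legitimate test function.\<close>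

lemma reverse_Carleson_kernels:
  assumes adm: "admissible \<mu> b" and b: "b \<in> Hinf_unit_ball" and H: "de_Branges_Rovnyak b H ip"
    and rC: "reverse_Carleson \<mu> H ip"
  obtains C where "C > 0" "\<And>w. cmod w < 1 \<Longrightarrow>
     ennreal ((1 - (cmod (b w))\<^sup>2) / (1 - (cmod w)\<^sup>2))
       \<le> ennreal (C\<^sup>2) * (\<integral>\<^sup>+z. ennreal ((cmod (nt_ext (dBR_kernel b w) z))\<^sup>2) \<partial>\<mu>)"
proof -
  obtain C where C: "C > 0" "\<And>f. f \<in> H \<Longrightarrow> admissible \<mu> f \<Longrightarrow> ennreal (ip_norm ip f) \<le> ennreal C * L2_norm \<mu> f"
    using rC by (auto simp: reverse_Carleson_def)
  interpret reproducing_kernel_hilbert_space unit_disc "dBR_kernel b" H ip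
    using H by (simp add: de_Branges_Rovnyak_def)
  show ?thesis
  proof (rule that[OF C(1)])
    fix w :: complex assume w: "cmod w < 1"
    let ?k = "dBR_kernel b w"
    let ?I = "\<integral>\<^sup>+z. ennreal ((cmod (nt_ext ?k z))\<^sup>2) \<partial>\<mu>"
    have k: "?k \<in> H" using w by (intro kernel_mem) simp
    have "admissible \<mu> ?k"
      unfolding admissible_def
    proof
      show "?k holomorphic_on unit_disc" using H k by (simp add: de_Branges_Rovnyak_def)
      have "AE \<zeta> in \<mu>. \<zeta> \<in> unit_circle \<longrightarrow> nt_convergent b \<zeta>" using adm by (simp add: admissible_def)
      then show "AE \<zeta> in \<mu>. \<zeta> \<in> unit_circle \<longrightarrow> nt_convergent ?k \<zeta>"
        by eventually_elim (use has_nt_limit_dBR_kernel[OF _ w] in \<open>auto simp: nt_convergent_def\<close>)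
    qed
    then have le: "ennreal (ip_norm ip ?k) \<le> ennreal C * L2_norm \<mu> ?k" using C(2) k by blast
    have bw: "(cmod (b w))\<^sup>2 \<le> 1" using b w by (simp add: Hinf_unit_ball_def power_le_one)
    have w2: "(cmod w)\<^sup>2 < 1" using w by (simp add: power_less_one_iff)
    have kk: "ip ?k ?k = of_real ((1 - (cmod (b w))\<^sup>2) / (1 - (cmod w)\<^sup>2))"
    proof -
      have "ip ?k ?k = ?k w" using k w by (intro reproducing) auto
      also have "\<dots> = (1 - cnj (b w) * b w) / (1 - cnj w * w)" using w by (simp add: dBR_kernel_def)
      also have "\<dots> = of_real ((1 - (cmod (b w))\<^sup>2) / (1 - (cmod w)\<^sup>2))"
        using complex_norm_square[of w] complex_norm_square[of "b w"] by (simp add: mult.commute)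
      finally show ?thesis .
    qed
    let ?q = "(1 - (cmod (b w))\<^sup>2) / (1 - (cmod w)\<^sup>2)"
    have q0: "0 \<le> ?q" using bw w2 by simp
    have nrm: "ip_norm ip ?k = sqrt ?q" unfolding ip_norm_def kk by simp
    show "ennreal ?q \<le> ennreal (C\<^sup>2) * ?I"
    proof (cases "?I = \<infinity>")
      case True
      then show ?thesis using C(1) by (simp add: ennreal_mult_top)
    next
      case False
      then have "L2_norm \<mu> ?k = ennreal (sqrt (enn2real ?I))" by (simp add: L2_norm_def Let_def)
      then have "ennreal (sqrt ?q) \<le> ennreal (C * sqrt (enn2real ?I))"
        using le C(1) by (simp add: nrm ennreal_mult')
      then have "sqrt ?q \<le> C * sqrt (enn2real ?I)"
        using C(1) by (subst (asm) ennreal_le_iff) auto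
      then have "(sqrt ?q)\<^sup>2 \<le> (C * sqrt (enn2real ?I))\<^sup>2" using q0 by (intro power_mono) auto
      then have "?q \<le> C\<^sup>2 * enn2real ?I" using q0 by (simp add: power_mult_distrib)
      then have "ennreal ?q \<le> ennreal (C\<^sup>2 * enn2real ?I)" by (rule ennreal_leI)
      also have "\<dots> = ennreal (C\<^sup>2) * ?I" using False by (simp add: ennreal_mult top.not_eq_extremum)
      finally show ?thesis .
    qed
  qed
qed

section \<open>Poisson-type potentials of subsets of the circle\<close>

text \<open>For \<open>|z| = 1\<close> this is the Poisson integral of the indicator of
  \<open>K\<close> at \<open>r * z\<close>. For \<open>|z| < 1\<close> the numerator remains
  \<open>1 - r^2\<close>, because it comes from the norm of the kernel at \<open>r * \<zeta>\<close>
  and not from \<open>z\<close>.\<close>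

definition circle_potential :: "complex set \<Rightarrow> real \<Rightarrow> complex \<Rightarrow> ennreal" where
  "circle_potential K r z = (\<integral>\<^sup>+\<zeta>\<in>K. ennreal ((1 - r\<^sup>2) / (cmod (\<zeta> - of_real r * z))\<^sup>2) \<partial>circle_measure)"

text \<open>For \<open>|z| \<le> 1\<close> the numerator is at most \<open>1 - |r * z|^2\<close>, so
  the integrand lies below the Poisson kernel at \<open>r * z\<close>, which has total mass
  1.\<close>

lemma circle_potential_le_1:
  assumes r: "0 \<le> r" "r < 1" and z: "cmod z \<le> 1"
  shows "circle_potential K r z \<le> 1"
proof -
  have rz: "cmod (of_real r * z) \<le> r" using r z by (simp add: norm_mult mult_left_le)
  have "circle_potential K r z \<le> (\<integral>\<^sup>+\<zeta>. ennreal ((1 - (cmod (of_real r * z))\<^sup>2) / (cmod (\<zeta> - of_real r * z))\<^sup>2) \<partial>circle_measure)"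
    unfolding circle_potential_def
  proof (rule nn_integral_mono)
    fix \<zeta>
    have "(cmod (of_real r * z))\<^sup>2 \<le> r\<^sup>2" using rz by (intro power_mono) auto
    then have "(1 - r\<^sup>2) / (cmod (\<zeta> - of_real r * z))\<^sup>2 \<le> (1 - (cmod (of_real r * z))\<^sup>2) / (cmod (\<zeta> - of_real r * z))\<^sup>2"
      by (intro divide_right_mono) auto
    then show "ennreal ((1 - r\<^sup>2) / (cmod (\<zeta> - of_real r * z))\<^sup>2) * indicator K \<zeta>
        \<le> ennreal ((1 - (cmod (of_real r * z))\<^sup>2) / (cmod (\<zeta> - of_real r * z))\<^sup>2)"
      by (auto simp: indicator_def intro: ennreal_leI)
  qed
  also have "\<dots> = 1" by (rule poisson_kernel_circle_measure) (use rz r in linarith)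
  finally show ?thesis .
qed

text \<open>At distance \<open>d\<close> from \<open>K\<close>, the points \<open>r n * z\<close>
  eventually stay \<open>d / 2\<close> away from \<open>K\<close>, and the integrand is bounded by a
  multiple of \<open>1 - (r n)^2\<close>. This treats points of the open disc and of the circle
  alike.\<close>

lemma circle_potential_tendsto_0:
  assumes K: "closed K" and z: "cmod z \<le> 1" "z \<notin> K"
    and r: "\<And>n. 0 \<le> r n \<and> r n < 1" "r \<longlonglongrightarrow> 1"
  shows "(\<lambda>n. circle_potential K (r n) z) \<longlonglongrightarrow> 0"
proof -
  obtain d where d: "d > 0" "\<And>\<zeta>. \<zeta> \<in> K \<Longrightarrow> d \<le> dist z \<zeta>"
    using separate_point_closed[OF K z(2)] by blast
  have "\<forall>\<^sub>F n in sequentially. circle_potential K (r n) z \<le> ennreal ((1 - (r n)\<^sup>2) / (d / 2)\<^sup>2)"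
  proof -
    have "\<forall>\<^sub>F n in sequentially. 1 - d / 2 < r n" using r(2) d(1) by (intro order_tendstoD) auto
    then show ?thesis
    proof eventually_elim
      case (elim n)
      have "circle_potential K (r n) z \<le> (\<integral>\<^sup>+\<zeta>. ennreal ((1 - (r n)\<^sup>2) / (d / 2)\<^sup>2) \<partial>circle_measure)"
        unfolding circle_potential_def
      proof (rule nn_integral_mono)
        fix \<zeta>
        show "ennreal ((1 - (r n)\<^sup>2) / (cmod (\<zeta> - of_real (r n) * z))\<^sup>2) * indicator K \<zeta> \<le> ennreal ((1 - (r n)\<^sup>2) / (d / 2)\<^sup>2)"
        proof (cases "\<zeta> \<in> K")
          case True
          have "z - of_real (r n) * z = of_real (1 - r n) * z" by (simp add: algebra_simps)
          then have "cmod (z - of_real (r n) * z) = \<bar>1 - r n\<bar> * cmod z" by (simp only: norm_mult norm_of_real)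
          also have "\<dots> \<le> 1 - r n" using r(1)[of n] z(1) by (simp add: mult_left_le)
          finally have "cmod (z - of_real (r n) * z) \<le> d / 2" using elim by simp
          moreover have "d \<le> cmod (\<zeta> - z)" using d(2)[OF True] by (simp add: dist_norm norm_minus_commute)
          moreover have "cmod (\<zeta> - z) \<le> cmod (\<zeta> - of_real (r n) * z) + cmod (z - of_real (r n) * z)"
            using norm_triangle_ineq4[of "\<zeta> - of_real (r n) * z" "z - of_real (r n) * z"] by simp
          ultimately have "d / 2 \<le> cmod (\<zeta> - of_real (r n) * z)" by simp
          then have "(1 - (r n)\<^sup>2) / (cmod (\<zeta> - of_real (r n) * z))\<^sup>2 \<le> (1 - (r n)\<^sup>2) / (d / 2)\<^sup>2"
            using d(1) r(1)[of n] by (intro divide_left_mono power_mono mult_pos_pos zero_less_power) (auto simp: power_le_one)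
          then show ?thesis using True by (simp add: ennreal_leI)
        qed simp
      qed
      also have "\<dots> = ennreal ((1 - (r n)\<^sup>2) / (d / 2)\<^sup>2)" by (simp add: emeasure_circle_measure_space)
      finally show ?case .
    qed
  qed
  moreover have "(\<lambda>n. ennreal ((1 - (r n)\<^sup>2) / (d / 2)\<^sup>2)) \<longlonglongrightarrow> 0"
  proof -
    have "(\<lambda>n. ennreal ((1 - (r n)\<^sup>2) / (d / 2)\<^sup>2)) \<longlonglongrightarrow> ennreal ((1 - 1\<^sup>2) / (d / 2)\<^sup>2)"
      using d(1) by (intro tendsto_ennrealI tendsto_intros r(2)) auto
    then show ?thesis by simp
  qed
  ultimately show ?thesis
    by (rule tendsto_sandwich[OF _ _ tendsto_const, rotated]) auto
qed

text \<open>Pushing \<open>circle_measure\<close> forward along the identity turns it into a finite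
  Borel measure on the plane, where approximation by compact sets is available; subsets of the
  circle keep their measure.\<close>

lemma inner_regular_circle_measure:
  assumes B: "B \<in> sets circle_measure"
  shows "emeasure circle_measure B = (SUP K \<in> {K. K \<subseteq> B \<and> compact K}. emeasure circle_measure K)"
proof -
  let ?m = "distr circle_measure borel (\<lambda>x. x)"
  have id: "(\<lambda>x. x) \<in> circle_measure \<rightarrow>\<^sub>M borel"
    by (auto intro: measurable_restrict_space1 cong: measurable_cong_sets)
  have eq: "emeasure ?m A = emeasure circle_measure A" if "A \<in> sets borel" "A \<subseteq> unit_circle" for A
    using that by (subst emeasure_distr[OF id]) (auto simp: Int_absorb2)
  have Bb: "B \<in> sets borel" "B \<subseteq> unit_circle"
    using B by (auto simp: sets_restrict_space_iff)
  have "emeasure ?m B = (SUP K \<in> {K. K \<subseteq> B \<and> compact K}. emeasure ?m K)"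
  proof (rule inner_regular)
    have "emeasure ?m UNIV = emeasure circle_measure unit_circle" by (subst emeasure_distr[OF id]) auto
    then show "emeasure ?m (space ?m) \<noteq> \<infinity>" by (simp add: emeasure_circle_measure_space)
  qed (use Bb in auto)
  also have "\<dots> = (SUP K \<in> {K. K \<subseteq> B \<and> compact K}. emeasure circle_measure K)"
    using Bb by (intro SUP_cong refl eq) (auto intro: borel_compact)
  finally show ?thesis using eq[OF Bb] by simp
qed

section \<open>Radial level sets and the kernel on them\<close>

text \<open>Conditions at interior points are closed in \<open>\<zeta>\<close>, which makes the set
  Borel without any knowledge of boundary values. The tolerance is relative to
  \<open>1 - |a|\<close>, so that \<open>1 - |b|\<close> and \<open>1 - |a|\<close> are comparable
  on the set.\<close>

definition radial_level_set :: "(complex \<Rightarrow> complex) \<Rightarrow> complex \<Rightarrow> nat \<Rightarrow> complex set" where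
  "radial_level_set b a k = {\<zeta> \<in> unit_circle. \<forall>r. 1 - 1 / real (Suc k) \<le> r \<and> r < 1 \<and> 0 \<le> r \<longrightarrow>
     cmod (b (of_real r * \<zeta>) - a) \<le> (1 - cmod a) / 4}"

lemma closed_radial_level_set:
  assumes "b holomorphic_on unit_disc"
  shows "closed (radial_level_set b a k)"
proof -
  let ?R = "{r. 1 - 1 / real (Suc k) \<le> r \<and> r < 1 \<and> 0 \<le> r}"
  have "closed (unit_circle \<inter> (\<lambda>\<zeta>. b (of_real r * \<zeta>)) -` cball a ((1 - cmod a) / 4))" if r: "r \<in> ?R" for r
  proof (rule continuous_closed_preimage)
    show "continuous_on unit_circle (\<lambda>\<zeta>. b (of_real r * \<zeta>))"
      by (rule continuous_on_compose2[OF holomorphic_on_imp_continuous_on[OF assms]])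
         (use r in \<open>auto intro!: continuous_intros simp: norm_mult\<close>)
  qed auto
  then have "closed (unit_circle \<inter> (\<Inter>r\<in>?R. unit_circle \<inter> (\<lambda>\<zeta>. b (of_real r * \<zeta>)) -` cball a ((1 - cmod a) / 4)))"
    by (intro closed_Int closed_INT) auto
  also have "unit_circle \<inter> (\<Inter>r\<in>?R. unit_circle \<inter> (\<lambda>\<zeta>. b (of_real r * \<zeta>)) -` cball a ((1 - cmod a) / 4)) = radial_level_set b a k"
    by (auto simp: radial_level_set_def dist_norm norm_minus_commute)
  finally show ?thesis .
qed

lemma nt_ext_radial_level_set:
  assumes "\<zeta> \<in> radial_level_set b a k" "nt_convergent b \<zeta>"
  shows "cmod (nt_ext b \<zeta> - a) \<le> (1 - cmod a) / 4"
proof (rule has_nt_limit_le)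
  show \<zeta>: "cmod \<zeta> = 1" using assms by (simp add: radial_level_set_def)
  show "has_nt_limit b \<zeta> (nt_ext b \<zeta>)" using nt_convergent_nt_ext[OF \<zeta> assms(2)] .
  show "1 - 1 / real (Suc k) < 1" by simp
  fix r :: real assume r: "1 - 1 / real (Suc k) \<le> r" "r < 1"
  moreover have "1 / real (Suc k) \<le> 1" by simp
  ultimately have "0 \<le> r" by linarith
  then show "cmod (b (of_real r * \<zeta>) - a) \<le> (1 - cmod a) / 4"
    using assms(1) r by (simp add: radial_level_set_def)
qed

lemma radial_level_set_cover:
  assumes D: "\<And>X. open X \<Longrightarrow> X \<noteq> {} \<Longrightarrow> \<exists>d\<in>D. d \<in> X"
    and \<zeta>: "cmod \<zeta> = 1" "nt_convergent b \<zeta>" "cmod (nt_ext b \<zeta>) < 1"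
  obtains a k where "a \<in> D" "cmod a < 1" "\<zeta> \<in> radial_level_set b a k"
proof -
  define L where "L = nt_ext b \<zeta>"
  \<comment> \<open>With \<open>8 * e = 1 - |L|\<close> and \<open>|L - a| < e\<close> one gets
    \<open>1 - |a| \<ge> 7 * e\<close>. The tolerance \<open>(1 - |a|) / 4\<close> then exceeds
    \<open>e\<close>, which leaves room for the radial limit.\<close>
  define e where "e = (1 - cmod L) / 8"
  have e: "e > 0" using \<zeta> by (simp add: e_def L_def)
  obtain a where a: "a \<in> D" "cmod (L - a) < e"
    using D[of "ball L e"] e by (auto simp: dist_norm)
  have aL: "cmod a \<le> cmod L + e" using norm_triangle_sub[of a L] a(2) by (simp add: norm_minus_commute)
  have "8 * e = 1 - cmod L" by (simp add: e_def)
  then have a1: "7 * e \<le> 1 - cmod a" using aL by simp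
  have "((\<lambda>r. b (of_real r * \<zeta>)) \<longlongrightarrow> L) (at_left 1)"
    unfolding L_def by (intro has_nt_limit_radial nt_convergent_nt_ext \<zeta>)
  then have "((\<lambda>r. cmod (b (of_real r * \<zeta>) - a)) \<longlongrightarrow> cmod (L - a)) (at_left 1)"
    by (intro tendsto_intros)
  then have "\<forall>\<^sub>F r in at_left 1. cmod (b (of_real r * \<zeta>) - a) < e"
    using a(2) by (rule order_tendstoD)
  then obtain r0 where r0: "r0 < 1" "\<And>r. r0 < r \<Longrightarrow> r < 1 \<Longrightarrow> cmod (b (of_real r * \<zeta>) - a) < e"
    unfolding eventually_at_left_field by blast
  obtain k where k: "inverse (real (Suc k)) < 1 - r0" using reals_Archimedean[of "1 - r0"] r0 by auto
  have "\<zeta> \<in> radial_level_set b a k"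
    unfolding radial_level_set_def
  proof (intro CollectI conjI allI impI)
    show "\<zeta> \<in> unit_circle" using \<zeta> by simp
    fix r assume r: "1 - 1 / real (Suc k) \<le> r \<and> r < 1 \<and> 0 \<le> r"
    then have "r0 < r" using k by (simp add: inverse_eq_divide)
    then show "cmod (b (of_real r * \<zeta>) - a) \<le> (1 - cmod a) / 4" using r0(2)[of r] r a1 e by simp
  qed
  moreover have "cmod a < 1" using a1 e by simp
  ultimately show ?thesis using that a(1) by blast
qed

lemma norm_kernel_numerator_le:
  assumes "cmod (x - a) \<le> (1 - cmod a) / 4" "cmod (y - a) \<le> (1 - cmod a) / 4" "cmod a < 1" "cmod x \<le> 1"
  shows "cmod (1 - cnj x * y) \<le> 5 / 2 * (1 - cmod a)"
proof -
  \<comment> \<open>Replacing \<open>x\<close> and \<open>y\<close> by \<open>a\<close> leaves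
    \<open>1 - |a|^2 \<le> 2 * (1 - |a|)\<close>, and each replacement costs a quarter of
    \<open>1 - |a|\<close>; this is the origin of \<open>5 / 2\<close>.\<close>
  have "1 - cnj x * y = of_real (1 - (cmod a)\<^sup>2) + (cnj (a - x) * a + cnj x * (a - y))"
    using complex_norm_square[of a] by (simp add: algebra_simps)
  then have "cmod (1 - cnj x * y) \<le> cmod (of_real (1 - (cmod a)\<^sup>2)) + cmod (cnj (a - x) * a + cnj x * (a - y))"
    by (metis norm_triangle_ineq)
  also have "\<dots> \<le> cmod (of_real (1 - (cmod a)\<^sup>2)) + (cmod (cnj (a - x) * a) + cmod (cnj x * (a - y)))"
    by (intro add_left_mono norm_triangle_ineq)
  finally have 0: "cmod (1 - cnj x * y) \<le> cmod (of_real (1 - (cmod a)\<^sup>2)) + (cmod (cnj (a - x) * a) + cmod (cnj x * (a - y)))" .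
  have 1: "cmod (of_real (1 - (cmod a)\<^sup>2)) \<le> 2 * (1 - cmod a)"
  proof -
    have "1 - (cmod a)\<^sup>2 = (1 + cmod a) * (1 - cmod a)" by (simp add: algebra_simps power2_eq_square)
    also have "\<dots> \<le> 2 * (1 - cmod a)" using assms by (intro mult_right_mono) auto
    finally have "1 - (cmod a)\<^sup>2 \<le> 2 * (1 - cmod a)" .
    moreover have "0 \<le> 1 - (cmod a)\<^sup>2" using assms by (simp add: power_le_one)
    ultimately show ?thesis unfolding norm_of_real by simp
  qed
  have 2: "cmod (cnj (a - x) * a) \<le> (1 - cmod a) / 4"
  proof -
    have "cmod (cnj (a - x) * a) = cmod (x - a) * cmod a" unfolding norm_mult complex_mod_cnj by (simp add: norm_minus_commute)
    also have "\<dots> \<le> cmod (x - a)" using assms by (simp add: mult_left_le)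
    finally show ?thesis using assms by simp
  qed
  have 3: "cmod (cnj x * (a - y)) \<le> (1 - cmod a) / 4"
  proof -
    have "cmod (cnj x * (a - y)) = cmod (y - a) * cmod x" by (simp add: norm_mult norm_minus_commute mult.commute)
    also have "\<dots> \<le> cmod (y - a)" using assms by (simp add: mult_left_le)
    finally show ?thesis using assms by simp
  qed
  have "2 * (1 - cmod a) + ((1 - cmod a) / 4 + (1 - cmod a) / 4) = 5 / 2 * (1 - cmod a)"
    by (simp add: field_simps)
  with 0 1 2 3 show ?thesis by linarith
qed

text \<open>Since \<open>|\<zeta>| = 1\<close>, the kernel's denominator has modulus
  \<open>|\<zeta> - r * z|\<close>. Its numerator is small only if \<open>b\<close> is near
  \<open>a\<close> at both \<open>r * \<zeta>\<close> and \<open>z\<close>, that is for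
  \<open>z\<close> in \<open>K\<close>; elsewhere the trivial bound \<open>2^2 = 4\<close> must
  do.\<close>

lemma nt_ext_dBR_kernel_bound:
  assumes b: "b \<in> Hinf_unit_ball" and K: "K \<subseteq> radial_level_set b a k" and a: "cmod a < 1"
    and \<zeta>: "\<zeta> \<in> K" and r: "1 - 1 / real (Suc k) \<le> r" "r < 1" "0 \<le> r"
    and z: "cmod z \<le> 1" "z \<in> unit_circle \<longrightarrow> nt_convergent b z"
  shows "(cmod (nt_ext (dBR_kernel b (of_real r * \<zeta>)) z))\<^sup>2
    \<le> (if z \<in> K then (5 / 2 * (1 - cmod a))\<^sup>2 else 4) / (cmod (\<zeta> - of_real r * z))\<^sup>2"
proof -
  let ?w = "of_real r * \<zeta>"
  have \<zeta>1: "cmod \<zeta> = 1" and \<zeta>E: "cmod (b ?w - a) \<le> (1 - cmod a) / 4"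
    using \<zeta> K r by (auto simp: radial_level_set_def)
  have w: "cmod ?w < 1" using \<zeta>1 r by (simp add: norm_mult)
  have bw: "cmod (b ?w) \<le> 1" using b w by (simp add: Hinf_unit_ball_def)
  have den: "cmod (1 - cnj ?w * z) = cmod (\<zeta> - of_real r * z)"
  proof -
    have "\<zeta> * cnj \<zeta> = 1" using \<zeta>1 complex_norm_square[of \<zeta>] by simp
    then have "\<zeta> * (1 - cnj ?w * z) = \<zeta> - of_real r * z" by (simp add: algebra_simps)
    then show ?thesis by (metis \<zeta>1 mult_1 norm_mult)
  qed
  define y where "y = nt_ext b z"
  have "nt_ext (dBR_kernel b ?w) z = (1 - cnj (b ?w) * y) / (1 - cnj ?w * z) \<and> cmod y \<le> 1
      \<and> (z \<in> K \<longrightarrow> cmod (y - a) \<le> (1 - cmod a) / 4)"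
  proof (cases "cmod z < 1")
    case True
    then have "z \<notin> K" using K by (auto simp: radial_level_set_def)
    then show ?thesis using True b by (simp add: y_def nt_ext_unit_disc dBR_kernel_def Hinf_unit_ball_def)
  next
    case False
    then have z1: "cmod z = 1" and nt: "nt_convergent b z" using z by auto
    have L: "has_nt_limit b z y" unfolding y_def using nt_convergent_nt_ext[OF z1 nt] .
    have "cmod (y - 0) \<le> 1"
    proof (rule has_nt_limit_le[OF z1 L, of 0])
      fix s :: real assume "0 \<le> s" "s < 1"
      then show "cmod (b (of_real s * z) - 0) \<le> 1" using b z1 by (simp add: Hinf_unit_ball_def norm_mult)
    qed simp
    moreover have "nt_ext (dBR_kernel b ?w) z = (1 - cnj (b ?w) * y) / (1 - cnj ?w * z)"
      by (rule nt_ext_circle[OF z1 has_nt_limit_dBR_kernel[OF z1 w L]])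
    moreover have "cmod (y - a) \<le> (1 - cmod a) / 4" if "z \<in> K"
      unfolding y_def using that K nt by (intro nt_ext_radial_level_set) auto
    ultimately show ?thesis by simp
  qed
  then have y: "nt_ext (dBR_kernel b ?w) z = (1 - cnj (b ?w) * y) / (1 - cnj ?w * z)" "cmod y \<le> 1"
      "z \<in> K \<Longrightarrow> cmod (y - a) \<le> (1 - cmod a) / 4" by auto
  have num: "(cmod (1 - cnj (b ?w) * y))\<^sup>2 \<le> (if z \<in> K then (5 / 2 * (1 - cmod a))\<^sup>2 else 4)"
  proof (cases "z \<in> K")
    case True
    then show ?thesis using norm_kernel_numerator_le[OF \<zeta>E y(3) a bw] by (simp add: power_mono)
  next
    case False
    have "cmod (1 - cnj (b ?w) * y) \<le> cmod 1 + cmod (cnj (b ?w) * y)" by (rule norm_triangle_ineq4)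
    also have "cmod (cnj (b ?w) * y) \<le> 1" using bw y(2) by (simp add: norm_mult mult_le_one)
    finally have "(cmod (1 - cnj (b ?w) * y))\<^sup>2 \<le> 2\<^sup>2" by (intro power_mono) auto
    then show ?thesis using False by simp
  qed
  show ?thesis
    unfolding y(1) norm_divide power_divide den by (rule divide_right_mono[OF num]) simp
qed

lemma measurable_circle_measure_borel [measurable]: "(\<lambda>x. x) \<in> circle_measure \<rightarrow>\<^sub>M borel"
  by (auto intro: measurable_restrict_space1 cong: measurable_cong_sets)

text \<open>Integrating the kernel inequality over \<open>\<zeta>\<close> in \<open>K\<close> and
  exchanging the integrals puts the \<open>\<zeta>\<close>-average of the Poisson-type kernel inside
  the integral over \<open>\<mu>\<close>. The limit is then governed by
  \<open>circle_potential\<close> alone.\<close>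

lemma compact_level_estimate:
  assumes \<mu>: "\<mu> \<in> disc_measures" and b: "b \<in> Hinf_unit_ball" and adm: "admissible \<mu> b"
    and C: "C > 0" and kernels: "\<And>w. cmod w < 1 \<Longrightarrow>
     ennreal ((1 - (cmod (b w))\<^sup>2) / (1 - (cmod w)\<^sup>2))
       \<le> ennreal (C\<^sup>2) * (\<integral>\<^sup>+z. ennreal ((cmod (nt_ext (dBR_kernel b w) z))\<^sup>2) \<partial>\<mu>)"
    and K: "compact K" "K \<subseteq> radial_level_set b a k" and a: "cmod a < 1"
  shows "ennreal (3 / 4 * (1 - cmod a)) * emeasure circle_measure K
    \<le> ennreal (C\<^sup>2) * (ennreal ((5 / 2 * (1 - cmod a))\<^sup>2) * emeasure \<mu> K)"
proof -
  interpret \<mu>: finite_measure \<mu> using \<mu> by (simp add: disc_measures_def)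
  have sets\<mu>: "sets \<mu> = sets (restrict_space borel (cball 0 1))" using \<mu> by (simp add: disc_measures_def)
  have sp\<mu>: "space \<mu> = cball 0 1" using sets_eq_imp_space_eq[OF sets\<mu>] by (simp add: space_restrict_space)
  interpret pair_sigma_finite circle_measure \<mu> by standard
  have id\<mu>[measurable]: "(\<lambda>x. x) \<in> \<mu> \<rightarrow>\<^sub>M borel"
    using sets\<mu> by (auto intro: measurable_restrict_space1 cong: measurable_cong_sets)
  have fstm[measurable]: "fst \<in> circle_measure \<Otimes>\<^sub>M \<mu> \<rightarrow>\<^sub>M borel"
    using measurable_compose[OF measurable_fst measurable_circle_measure_borel] by simp
  have sndm[measurable]: "snd \<in> circle_measure \<Otimes>\<^sub>M \<mu> \<rightarrow>\<^sub>M borel"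
    using measurable_compose[OF measurable_snd id\<mu>] by simp
  have Kb[measurable]: "K \<in> sets borel" using K(1) by (rule borel_compact)
  have KT: "K \<subseteq> unit_circle" using K(2) by (auto simp: radial_level_set_def)
  have Kc: "K \<in> sets circle_measure" using KT by (simp add: sets_restrict_space_iff)
  have K\<mu>: "K \<in> sets \<mu>" unfolding sets\<mu> using KT by (auto simp: sets_restrict_space_iff)
  let ?t = "1 - cmod a"
  \<comment> \<open>A two-valued bound for the squared kernel numerator that depends on
    \<open>z\<close> only, so it factors out of the integral over \<open>\<zeta>\<close>.\<close>
  define W where "W z = (if z \<in> K then (5 / 2 * ?t)\<^sup>2 else 4)" for z
  have W[measurable]: "W \<in> borel_measurable borel" unfolding W_def by measurable
  have W0: "0 \<le> W z" for z by (simp add: W_def)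
  define P where "P r \<zeta> z = (1 - r\<^sup>2) / (cmod (\<zeta> - of_real r * z))\<^sup>2" for r :: real and \<zeta> z :: complex
  \<comment> \<open>These radii match the thresholds in \<open>radial_level_set\<close>, so
    \<open>k \<le> n\<close> suffices for every point of \<open>K\<close>.\<close>
  define r where "r n = 1 - 1 / real (Suc n)" for n
  have r01: "0 \<le> r n" "r n < 1" for n by (auto simp: r_def)
  have rlim: "r \<longlonglongrightarrow> 1"
    unfolding r_def using tendsto_diff[OF tendsto_const LIMSEQ_inverse_real_of_nat, of 1] by (simp add: inverse_eq_divide)
  have point: "ennreal (3 / 4 * ?t) \<le> ennreal (C\<^sup>2) * (\<integral>\<^sup>+z. ennreal (W z) * ennreal (P (r n) \<zeta> z) \<partial>\<mu>)"
    if n: "k \<le> n" and \<zeta>: "\<zeta> \<in> K" for n \<zeta>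
  proof -
    let ?w = "of_real (r n) * \<zeta>"
    have rk: "1 - 1 / real (Suc k) \<le> r n" unfolding r_def using n by (simp add: frac_le)
    have \<zeta>1: "cmod \<zeta> = 1" using \<zeta> KT by auto
    have w: "cmod ?w = r n" using \<zeta>1 r01[of n] by (simp add: norm_mult)
    then have w1: "cmod ?w < 1" using r01 by simp
    have rn2: "0 < 1 - (r n)\<^sup>2" using r01[of n] by (simp add: power_less_one_iff)
    have "cmod (b ?w) \<le> cmod (b ?w - a) + cmod a" using norm_triangle_sub[of "b ?w" a] by simp
    moreover have "cmod (b ?w - a) \<le> ?t / 4" using \<zeta> K(2) rk r01 by (auto simp: radial_level_set_def)
    ultimately have "3 / 4 * ?t \<le> 1 - cmod (b ?w)" by (simp add: field_simps)
    also have "\<dots> \<le> 1 - (cmod (b ?w))\<^sup>2"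
      using b w1 by (simp add: Hinf_unit_ball_def power2_eq_square mult_left_le)
    finally have "ennreal (3 / 4 * ?t) \<le> ennreal (1 - (cmod (b ?w))\<^sup>2)" by (rule ennreal_leI)
    also have "\<dots> = ennreal (1 - (r n)\<^sup>2) * ennreal ((1 - (cmod (b ?w))\<^sup>2) / (1 - (cmod ?w)\<^sup>2))"
      unfolding w using rn2 by (simp flip: ennreal_mult')
    also have "\<dots> \<le> ennreal (1 - (r n)\<^sup>2) * (ennreal (C\<^sup>2) * (\<integral>\<^sup>+z. ennreal ((cmod (nt_ext (dBR_kernel b ?w) z))\<^sup>2) \<partial>\<mu>))"
      by (intro mult_left_mono kernels w1) simp
    also have "\<dots> \<le> ennreal (1 - (r n)\<^sup>2) * (ennreal (C\<^sup>2) * (\<integral>\<^sup>+z. ennreal (W z / (cmod (\<zeta> - of_real (r n) * z))\<^sup>2) \<partial>\<mu>))"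
    proof (intro mult_left_mono nn_integral_mono_AE)
      have "AE z in \<mu>. z \<in> unit_circle \<longrightarrow> nt_convergent b z" using adm by (simp add: admissible_def)
      moreover have "AE z in \<mu>. z \<in> space \<mu>" by (rule AE_space)
      ultimately show "AE z in \<mu>. ennreal ((cmod (nt_ext (dBR_kernel b ?w) z))\<^sup>2) \<le> ennreal (W z / (cmod (\<zeta> - of_real (r n) * z))\<^sup>2)"
      proof eventually_elim
        case (elim z)
        then show ?case unfolding W_def
          by (intro ennreal_leI nt_ext_dBR_kernel_bound[OF b K(2) a \<zeta> rk]) (use r01 sp\<mu> in auto)
      qed
    qed simp_all
    also have "\<dots> = ennreal (C\<^sup>2) * (ennreal (1 - (r n)\<^sup>2) * (\<integral>\<^sup>+z. ennreal (W z / (cmod (\<zeta> - of_real (r n) * z))\<^sup>2) \<partial>\<mu>))"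
      by (simp add: mult.left_commute)
    also have "ennreal (1 - (r n)\<^sup>2) * (\<integral>\<^sup>+z. ennreal (W z / (cmod (\<zeta> - of_real (r n) * z))\<^sup>2) \<partial>\<mu>)
        = (\<integral>\<^sup>+z. ennreal (1 - (r n)\<^sup>2) * ennreal (W z / (cmod (\<zeta> - of_real (r n) * z))\<^sup>2) \<partial>\<mu>)"
      by (rule nn_integral_cmult[symmetric]) measurable
    also have "\<dots> = (\<integral>\<^sup>+z. ennreal (W z) * ennreal (P (r n) \<zeta> z) \<partial>\<mu>)"
      by (rule nn_integral_cong) (use rn2 W0 in \<open>simp add: P_def mult.commute flip: ennreal_mult\<close>)
    finally show ?thesis .
  qed
  \<comment> \<open>The contribution from outside \<open>K\<close>. Its integrand is at most 4,
    which is integrable because \<open>\<mu>\<close> is finite.\<close>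
  define R where "R n = (\<integral>\<^sup>+z. ennreal 4 * indicator (- K) z * circle_potential K (r n) z \<partial>\<mu>)" for n
  have Pm[measurable]: "(\<lambda>p. ennreal (P (r n) (fst p) (snd p))) \<in> borel_measurable (circle_measure \<Otimes>\<^sub>M \<mu>)" for n
    unfolding P_def by measurable
  have pot_m[measurable]: "circle_potential K (r n) \<in> borel_measurable \<mu>" for n
  proof -
    have "(\<lambda>z. \<integral>\<^sup>+\<zeta>. ennreal (P (r n) \<zeta> z) * indicator K \<zeta> \<partial>circle_measure) \<in> borel_measurable \<mu>"
      unfolding P_def by measurable
    then show ?thesis by (simp add: circle_potential_def[abs_def] P_def)
  qed
  have int: "ennreal (3 / 4 * ?t) * emeasure circle_measure K
      \<le> ennreal (C\<^sup>2) * (ennreal ((5 / 2 * ?t)\<^sup>2) * emeasure \<mu> K + R n)" if n: "k \<le> n" for n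
  proof -
    have "ennreal (3 / 4 * ?t) * emeasure circle_measure K = (\<integral>\<^sup>+\<zeta>. ennreal (3 / 4 * ?t) * indicator K \<zeta> \<partial>circle_measure)"
      using Kc by (simp add: nn_integral_cmult_indicator)
    also have "\<dots> \<le> (\<integral>\<^sup>+\<zeta>. ennreal (C\<^sup>2) * (\<integral>\<^sup>+z. ennreal (W z) * ennreal (P (r n) \<zeta> z) * indicator K \<zeta> \<partial>\<mu>) \<partial>circle_measure)"
    proof (rule nn_integral_mono)
      fix \<zeta>
      show "ennreal (3 / 4 * ?t) * indicator K \<zeta>
          \<le> ennreal (C\<^sup>2) * (\<integral>\<^sup>+z. ennreal (W z) * ennreal (P (r n) \<zeta> z) * indicator K \<zeta> \<partial>\<mu>)"
        using point[OF n] by (cases "\<zeta> \<in> K") auto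
    qed
    also have "\<dots> = ennreal (C\<^sup>2) * (\<integral>\<^sup>+\<zeta>. (\<integral>\<^sup>+z. ennreal (W z) * ennreal (P (r n) \<zeta> z) * indicator K \<zeta> \<partial>\<mu>) \<partial>circle_measure)"
      by (rule nn_integral_cmult) (unfold P_def, measurable)
    also have "(\<integral>\<^sup>+\<zeta>. (\<integral>\<^sup>+z. ennreal (W z) * ennreal (P (r n) \<zeta> z) * indicator K \<zeta> \<partial>\<mu>) \<partial>circle_measure)
        = (\<integral>\<^sup>+z. (\<integral>\<^sup>+\<zeta>. ennreal (W z) * ennreal (P (r n) \<zeta> z) * indicator K \<zeta> \<partial>circle_measure) \<partial>\<mu>)"
      by (rule Fubini'[symmetric]) (unfold P_def case_prod_beta, measurable)
    also have "\<dots> = (\<integral>\<^sup>+z. ennreal (W z) * circle_potential K (r n) z \<partial>\<mu>)"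
    proof (rule nn_integral_cong)
      fix z
      have "(\<integral>\<^sup>+\<zeta>. ennreal (W z) * (ennreal (P (r n) \<zeta> z) * indicator K \<zeta>) \<partial>circle_measure)
          = ennreal (W z) * (\<integral>\<^sup>+\<zeta>. ennreal (P (r n) \<zeta> z) * indicator K \<zeta> \<partial>circle_measure)"
        by (rule nn_integral_cmult) (unfold P_def, measurable)
      then show "(\<integral>\<^sup>+\<zeta>. ennreal (W z) * ennreal (P (r n) \<zeta> z) * indicator K \<zeta> \<partial>circle_measure) = ennreal (W z) * circle_potential K (r n) z"
        by (simp add: circle_potential_def P_def mult.assoc)
    qed
    \<comment> \<open>No limit is taken at points of \<open>K\<close>: there the potential is
      replaced by its bound 1, and \<open>W\<close> already carries the small factor.\<close>
    also have "\<dots> \<le> (\<integral>\<^sup>+z. ennreal ((5 / 2 * ?t)\<^sup>2) * indicator K z + ennreal 4 * indicator (- K) z * circle_potential K (r n) z \<partial>\<mu>)"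
    proof (rule nn_integral_mono)
      fix z assume "z \<in> space \<mu>"
      then have "circle_potential K (r n) z \<le> 1" using r01 sp\<mu> by (intro circle_potential_le_1) auto
      then have "ennreal ((5 / 2 * ?t)\<^sup>2) * circle_potential K (r n) z \<le> ennreal ((5 / 2 * ?t)\<^sup>2) * 1" by (rule mult_left_mono) simp
      then show "ennreal (W z) * circle_potential K (r n) z
          \<le> ennreal ((5 / 2 * ?t)\<^sup>2) * indicator K z + ennreal 4 * indicator (- K) z * circle_potential K (r n) z"
        by (cases "z \<in> K") (auto simp: W_def)
    qed
    also have "\<dots> = (\<integral>\<^sup>+z. ennreal ((5 / 2 * ?t)\<^sup>2) * indicator K z \<partial>\<mu>) + R n"
      unfolding R_def using K\<mu> by (intro nn_integral_add) measurable
    also have "(\<integral>\<^sup>+z. ennreal ((5 / 2 * ?t)\<^sup>2) * indicator K z \<partial>\<mu>) = ennreal ((5 / 2 * ?t)\<^sup>2) * emeasure \<mu> K"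
      using K\<mu> by (simp add: nn_integral_cmult_indicator)
    finally show ?thesis by (simp add: mult_left_mono)
  qed
  have "R \<longlonglongrightarrow> (\<integral>\<^sup>+z. 0 \<partial>\<mu>)"
    unfolding R_def
  proof (rule nn_integral_dominated_convergence[where w="\<lambda>_. ennreal 4"])
    show "AE z in \<mu>. ennreal 4 * indicator (- K) z * circle_potential K (r n) z \<le> ennreal 4" for n
    proof (rule AE_I2)
      fix z assume "z \<in> space \<mu>"
      then have "circle_potential K (r n) z \<le> 1" using r01 sp\<mu> by (intro circle_potential_le_1) auto
      then have "ennreal 4 * circle_potential K (r n) z \<le> ennreal 4 * 1" by (rule mult_left_mono) simp
      then show "ennreal 4 * indicator (- K) z * circle_potential K (r n) z \<le> ennreal 4" by (cases "z \<in> K") auto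
    qed
    show "AE z in \<mu>. (\<lambda>n. ennreal 4 * indicator (- K) z * circle_potential K (r n) z) \<longlonglongrightarrow> 0"
    proof (rule AE_I2)
      fix z assume z: "z \<in> space \<mu>"
      show "(\<lambda>n. ennreal 4 * indicator (- K) z * circle_potential K (r n) z) \<longlonglongrightarrow> 0"
      proof (cases "z \<in> K")
        case False
        have "(\<lambda>n. circle_potential K (r n) z) \<longlonglongrightarrow> 0"
          by (rule circle_potential_tendsto_0) (use K(1) compact_imp_closed False z sp\<mu> r01 rlim in auto)
        then have "(\<lambda>n. ennreal 4 * circle_potential K (r n) z) \<longlonglongrightarrow> ennreal 4 * 0"
          by (rule ennreal_tendsto_cmult[rotated]) simp
        then show ?thesis using False by simp
      qed simp
    qed
    show "(\<integral>\<^sup>+z. ennreal 4 \<partial>\<mu>) < \<infinity>" by (auto simp: ennreal_mult_eq_top_iff less_top[symmetric])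
  qed measurable
  then have "(\<lambda>n. ennreal (C\<^sup>2) * (ennreal ((5 / 2 * ?t)\<^sup>2) * emeasure \<mu> K + R n))
      \<longlonglongrightarrow> ennreal (C\<^sup>2) * (ennreal ((5 / 2 * ?t)\<^sup>2) * emeasure \<mu> K + 0)"
    by (intro ennreal_tendsto_cmult tendsto_add tendsto_const) auto
  then have "ennreal (3 / 4 * ?t) * emeasure circle_measure K
      \<le> ennreal (C\<^sup>2) * (ennreal ((5 / 2 * ?t)\<^sup>2) * emeasure \<mu> K + 0)"
    by (rule LIMSEQ_le_const) (use int in blast)
  then show ?thesis by simp
qed

text \<open>The compact estimate is multiplied by \<open>16 / (9 * t^2)\<close>, so that the left
  coefficient \<open>3 / 4 * t\<close> becomes \<open>4 / (3 * t)\<close>, the upper bound for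
  \<open>1 / (1 - |b|)\<close> on the level set. On the right
  \<open>16 / 9 * 25 / 4 = 100 / 9\<close> is rounded up to 12. Inner regularity then extends the
  estimate to Borel sets, which need not be closed.\<close>

lemma level_set_estimate:
  assumes \<mu>: "\<mu> \<in> disc_measures" and b: "b \<in> Hinf_unit_ball" and adm: "admissible \<mu> b"
    and C: "C > 0" and kernels: "\<And>w. cmod w < 1 \<Longrightarrow>
     ennreal ((1 - (cmod (b w))\<^sup>2) / (1 - (cmod w)\<^sup>2))
       \<le> ennreal (C\<^sup>2) * (\<integral>\<^sup>+z. ennreal ((cmod (nt_ext (dBR_kernel b w) z))\<^sup>2) \<partial>\<mu>)"
    and B: "B \<in> sets circle_measure" "B \<subseteq> radial_level_set b a k" and a: "cmod a < 1"
  shows "ennreal (4 / (3 * (1 - cmod a))) * emeasure circle_measure B \<le> ennreal (12 * C\<^sup>2) * emeasure \<mu> B"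
proof -
  have sets\<mu>: "sets \<mu> = sets (restrict_space borel (cball 0 1))" using \<mu> by (simp add: disc_measures_def)
  have B\<mu>: "B \<in> sets \<mu>" unfolding sets\<mu> using B(1) by (auto simp: sets_restrict_space_iff)
  define t where "t = 1 - cmod a"
  have t: "t > 0" using a by (simp add: t_def)
  have comp: "ennreal (4 / (3 * t)) * emeasure circle_measure K \<le> ennreal (12 * C\<^sup>2) * emeasure \<mu> B"
    if K: "K \<subseteq> B" "compact K" for K
  proof -
    have "ennreal (4 / (3 * t)) * emeasure circle_measure K
        = ennreal (16 / (9 * t\<^sup>2)) * (ennreal (3 / 4 * t) * emeasure circle_measure K)"
    proof -
      have "16 / (9 * t\<^sup>2) * (3 / 4 * t) = 4 / (3 * t)" using t by (simp add: power2_eq_square)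
      moreover have "ennreal (16 / (9 * t\<^sup>2) * (3 / 4 * t)) = ennreal (16 / (9 * t\<^sup>2)) * ennreal (3 / 4 * t)"
        using t by (intro ennreal_mult) auto
      ultimately show ?thesis by (simp only: mult.assoc)
    qed
    also have "\<dots> \<le> ennreal (16 / (9 * t\<^sup>2)) * (ennreal (C\<^sup>2) * (ennreal ((5 / 2 * t)\<^sup>2) * emeasure \<mu> K))"
      using compact_level_estimate[OF \<mu> b adm C kernels K(2) order_trans[OF K(1) B(2)] a]
      unfolding t_def by (intro mult_left_mono) simp_all
    also have "\<dots> = ennreal (100 / 9 * C\<^sup>2) * emeasure \<mu> K"
    proof -
      have "16 / (9 * t\<^sup>2) * (C\<^sup>2 * (5 / 2 * t)\<^sup>2) = 100 / 9 * C\<^sup>2"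
        using t by (simp add: power2_eq_square)
      moreover have "ennreal (x * (y * z)) = ennreal x * (ennreal y * ennreal z)"
        if "0 \<le> x" "0 \<le> y" "0 \<le> z" for x y z
        using that by (simp add: ennreal_mult)
      then have "ennreal (16 / (9 * t\<^sup>2) * (C\<^sup>2 * (5 / 2 * t)\<^sup>2))
          = ennreal (16 / (9 * t\<^sup>2)) * (ennreal (C\<^sup>2) * ennreal ((5 / 2 * t)\<^sup>2))"
        by this simp_all
      ultimately show ?thesis by (simp only: mult.assoc)
    qed
    also have "\<dots> \<le> ennreal (12 * C\<^sup>2) * emeasure \<mu> B"
      using K(1) B\<mu> by (intro mult_mono ennreal_leI emeasure_mono mult_right_mono) auto
    finally show ?thesis .
  qed
  have "ennreal (4 / (3 * t)) * emeasure circle_measure B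
      = (SUP K \<in> {K. K \<subseteq> B \<and> compact K}. ennreal (4 / (3 * t)) * emeasure circle_measure K)"
    unfolding inner_regular_circle_measure[OF B(1)]
    by (rule SUP_mult_left_ennreal)
  also have "\<dots> \<le> ennreal (12 * C\<^sup>2) * emeasure \<mu> B"
    by (rule SUP_least) (use comp in auto)
  finally show ?thesis unfolding t_def .
qed


theorem corollary1p7:
  fixes \<mu> :: "complex measure"
    and b :: "complex \<Rightarrow> complex"
    and H :: "(complex \<Rightarrow> complex) set"
    and ip :: "(complex \<Rightarrow> complex) \<Rightarrow> (complex \<Rightarrow> complex) \<Rightarrow> complex"
    and h :: "complex \<Rightarrow> ennreal"
    and Z :: "complex set"
  assumes "\<mu> \<in> disc_measures"
    and "b \<in> Hinf_unit_ball"
    and "admissible \<mu> b"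
    and "\<not> inner_function b"
    and "de_Branges_Rovnyak b H ip"
    and "h = circle_density \<mu>"
    and "Z = {\<zeta> \<in> unit_circle. nt_convergent b \<zeta> \<and> cmod (nt_ext b \<zeta>) < 1}"
    and "reverse_Carleson \<mu> H ip"
  shows "\<not> (AE \<zeta> in circle_measure. h \<zeta> = 0) \<and>
         (\<integral>\<^sup>+ \<zeta>\<in>Z. ennreal (1 / (1 - cmod (nt_ext b \<zeta>))) \<partial>circle_measure) < \<infinity>"
proof -
  note \<mu> = assms(1) and b = assms(2) and adm = assms(3) and Z = assms(7)
  interpret \<mu>: finite_measure \<mu> using \<mu> by (simp add: disc_measures_def)
  have sets\<mu>: "sets \<mu> = sets (restrict_space borel (cball 0 1))" using \<mu> by (simp add: disc_measures_def)
  have sets_sub: "B \<in> sets \<mu>" if "B \<in> sets circle_measure" for B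
    unfolding sets\<mu> using that by (auto simp: sets_restrict_space_iff)
  obtain C where C: "C > 0" "\<And>w. cmod w < 1 \<Longrightarrow>
     ennreal ((1 - (cmod (b w))\<^sup>2) / (1 - (cmod w)\<^sup>2))
       \<le> ennreal (C\<^sup>2) * (\<integral>\<^sup>+z. ennreal ((cmod (nt_ext (dBR_kernel b w) z))\<^sup>2) \<partial>\<mu>)"
    using reverse_Carleson_kernels[OF adm b assms(5,8)] by blast
  note estimate = level_set_estimate[OF \<mu> b adm C]
  obtain D :: "complex set" where D: "countable D" "\<And>X. open X \<Longrightarrow> X \<noteq> {} \<Longrightarrow> \<exists>d\<in>D. d \<in> X"
    by (rule countable_dense_setE) blast
  \<comment> \<open>The point 0 ensures that \<open>I\<close> is nonempty, as the enumeration by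
    \<open>from_nat_into\<close> requires. Repetitions in the enumeration disappear when the sets
    are made disjoint.\<close>
  define I where "I = (insert 0 D \<inter> ball 0 1) \<times> (UNIV :: nat set)"
  have I: "countable I" "I \<noteq> {}" using D(1) by (auto simp: I_def)
  define a where "a n = fst (from_nat_into I n)" for n
  define E where "E n = radial_level_set b (a n) (snd (from_nat_into I n))" for n
  have a: "cmod (a n) < 1" for n
    using from_nat_into[OF I(2), of n] by (auto simp: I_def a_def)
  have E[measurable]: "E n \<in> sets circle_measure" for n
  proof -
    have "closed (E n)" unfolding E_def using b by (intro closed_radial_level_set) (simp add: Hinf_unit_ball_def)
    moreover have "E n \<subseteq> unit_circle" by (auto simp: E_def radial_level_set_def)
    ultimately show ?thesis by (auto simp: sets_restrict_space_iff)
  qed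
  have cover: "Z \<subseteq> (\<Union>n. E n)"
  proof
    fix \<zeta> assume "\<zeta> \<in> Z"
    then obtain c k where "c \<in> D" "cmod c < 1" "\<zeta> \<in> radial_level_set b c k"
      using radial_level_set_cover[OF D(2), of \<zeta> b] unfolding Z by auto
    moreover from this have "(c, k) \<in> I" by (simp add: I_def)
    then obtain n where "from_nat_into I n = (c, k)" using I by (metis from_nat_into_surj)
    ultimately have "\<zeta> \<in> E n" by (simp add: E_def a_def)
    then show "\<zeta> \<in> (\<Union>n. E n)" by blast
  qed
  \<comment> \<open>On \<open>E n\<close> the boundary value satisfies
    \<open>1 - |b| \<ge> 3 / 4 * (1 - |a n|)\<close>, so \<open>c n\<close> majorizes the integrand
    on \<open>Z \<inter> E n\<close>.\<close>
  define c where "c n = ennreal (4 / (3 * (1 - cmod (a n))))" for n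
  have c_pos: "c n \<noteq> 0" for n using a[of n] by (simp add: c_def)
  have est: "c n * emeasure circle_measure B \<le> ennreal (12 * C\<^sup>2) * emeasure \<mu> B"
    if "B \<in> sets circle_measure" "B \<subseteq> E n" for B n
    unfolding c_def by (rule estimate) (use that a in \<open>auto simp: E_def\<close>)
  have "\<not> (AE \<zeta> in circle_measure. h \<zeta> = 0)"
  proof
    assume "AE \<zeta> in circle_measure. h \<zeta> = 0"
    then obtain S where S: "S \<in> null_sets circle_measure" "emeasure \<mu> (unit_circle - S) = 0"
      using circle_density_zero_imp_singular[OF \<mu>] unfolding assms(6) by blast
    have "E n \<in> null_sets circle_measure" for n
    proof -
      have Sm: "S \<in> sets circle_measure" using S(1) by auto
      then have ES: "E n - S \<in> sets circle_measure" by measurable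
      have "unit_circle - S \<in> sets circle_measure" using sets.compl_sets[OF Sm] by simp
      then have "emeasure \<mu> (E n - S) \<le> emeasure \<mu> (unit_circle - S)"
        using sets_sub by (intro emeasure_mono) (auto simp: E_def radial_level_set_def)
      then have "emeasure \<mu> (E n - S) = 0" using S(2) by simp
      then have "c n * emeasure circle_measure (E n - S) = 0" using est[OF ES, of n] by auto
      then have "emeasure circle_measure (E n - S) = 0" using c_pos[of n] by simp
      moreover have "emeasure circle_measure (E n - S) = emeasure circle_measure (E n)"
        by (rule emeasure_Diff_null_set[OF S(1) E])
      ultimately show ?thesis using E by auto
    qed
    then have "(\<Union>n. E n) \<in> null_sets circle_measure" by auto
    then have "AE \<zeta> in circle_measure. \<zeta> \<notin> (\<Union>n. E n)" by (rule AE_not_in)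
    moreover have "AE \<zeta> in circle_measure. \<zeta> \<in> space circle_measure" by (rule AE_space)
    moreover have "AE \<zeta> in circle_measure. nt_convergent b \<zeta>" by (rule Fatou_nontangential[OF b])
    ultimately have "AE \<zeta> in circle_measure. nt_convergent b \<zeta> \<and> cmod (nt_ext b \<zeta>) = 1"
    proof eventually_elim
      case (elim \<zeta>)
      have \<zeta>: "cmod \<zeta> = 1" using elim by simp
      have "cmod (nt_ext b \<zeta> - 0) \<le> 1"
      proof (rule has_nt_limit_le[OF \<zeta> nt_convergent_nt_ext[OF \<zeta>], of b 0])
        fix s :: real assume "0 \<le> s" "s < 1"
        then show "cmod (b (of_real s * \<zeta>) - 0) \<le> 1" using b \<zeta> by (simp add: Hinf_unit_ball_def norm_mult)
      qed (use elim in auto)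
      moreover have "\<not> cmod (nt_ext b \<zeta>) < 1" using elim cover \<zeta> unfolding Z by auto
      ultimately show ?case using elim by simp
    qed
    then show False using assms(4) b by (simp add: inner_function_def)
  qed
  moreover have "(\<integral>\<^sup>+ \<zeta>\<in>Z. ennreal (1 / (1 - cmod (nt_ext b \<zeta>))) \<partial>circle_measure) < \<infinity>"
  proof -
    \<comment> \<open>The level sets overlap, so summing over \<open>E n\<close> could count the
      mass of \<open>\<mu>\<close> infinitely often. The estimate holds for every Borel subset of
      \<open>E n\<close>, in particular for these disjoint pieces.\<close>
    define F where "F = disjointed E"
    have F[measurable]: "F n \<in> sets circle_measure" for n
      unfolding F_def using sets.range_disjointed_sets[of E circle_measure] E by blast
    have FE: "F n \<subseteq> E n" for n unfolding F_def by (rule disjointed_subset)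
    have FU: "(\<Union>n. F n) = (\<Union>n. E n)" unfolding F_def by (rule UN_disjointed_eq)
    have Fd: "disjoint_family F" unfolding F_def by (rule disjoint_family_disjointed)
    have "(\<integral>\<^sup>+ \<zeta>\<in>Z. ennreal (1 / (1 - cmod (nt_ext b \<zeta>))) \<partial>circle_measure)
        \<le> (\<integral>\<^sup>+\<zeta>. (\<Sum>n. c n * indicator (F n) \<zeta>) \<partial>circle_measure)"
    proof (rule nn_integral_mono)
      fix \<zeta>
      show "ennreal (1 / (1 - cmod (nt_ext b \<zeta>))) * indicator Z \<zeta> \<le> (\<Sum>n. c n * indicator (F n) \<zeta>)"
      proof (cases "\<zeta> \<in> Z")
        case True
        then obtain n where n: "\<zeta> \<in> F n" using cover FU by blast
        let ?t = "1 - cmod (a n)"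
        have "cmod (nt_ext b \<zeta> - a n) \<le> ?t / 4"
          using n FE True unfolding E_def Z by (intro nt_ext_radial_level_set) auto
        then have "3 / 4 * ?t \<le> 1 - cmod (nt_ext b \<zeta>)"
          using norm_triangle_sub[of "nt_ext b \<zeta>" "a n"] by (simp add: field_simps)
        moreover have "0 < 3 / 4 * ?t" using a[of n] by simp
        ultimately have "1 / (1 - cmod (nt_ext b \<zeta>)) \<le> 1 / (3 / 4 * ?t)"
          by (intro divide_left_mono mult_pos_pos) auto
        also have "\<dots> = 4 / (3 * ?t)" by simp
        finally have "ennreal (1 / (1 - cmod (nt_ext b \<zeta>))) * indicator Z \<zeta> \<le> c n * indicator (F n) \<zeta>"
          using True n by (simp add: c_def ennreal_leI)
        also have "\<dots> \<le> (\<Sum>n. c n * indicator (F n) \<zeta>)"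
          using sum_le_suminf[of "\<lambda>n. c n * indicator (F n) \<zeta>" "{n}"]
          by (simp only: sum.empty sum.insert finite.intros empty_iff not_False_eq_True add_0_right summableI) simp
        finally show ?thesis .
      qed simp
    qed
    also have "\<dots> = (\<Sum>n. c n * emeasure circle_measure (F n))"
      by (subst nn_integral_suminf, measurable) (simp only: nn_integral_cmult_indicator[OF F])
    also have "\<dots> \<le> (\<Sum>n. ennreal (12 * C\<^sup>2) * emeasure \<mu> (F n))"
      by (intro suminf_le est F FE) auto
    also have "\<dots> = ennreal (12 * C\<^sup>2) * emeasure \<mu> (\<Union>n. F n)"
      using sets_sub F Fd by (simp add: suminf_emeasure[symmetric] image_subset_iff)
    also have "\<dots> < \<infinity>" by (auto simp: ennreal_mult_eq_top_iff less_top[symmetric])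
    finally show ?thesis .
  qed
  ultimately show ?thesis by simp
qed

end
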